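(* Let $\vartheta_{\mathbf P}=(\vartheta,\mathbf P)$ be a compatible, irreducible Pisot random substitution on $\mathcal A=\{1,\dots,d\}$. There exists a vector of finite measures $\overline\mu=(\overline\mu_a)_{a\in\mathcal A}$ on $\mathbb H$ such that, for all $v\in\mathcal A^+$, $$\lim_{n\to\infty}\frac{1}{|\vartheta^n(v)|}\bigl(\mathbb E[\mu_a(\vartheta_{\mathbf P}^n(v))]\bigr)_{a\in\mathcal A}=\overline\mu$$ in the sense of weak convergence. Further, $\|\overline\mu\|=\mathbf R$, where $\|\overline\mu\|=(\overline\mu_a(\mathbb H))_{a\in\mathcal A}$ is the vector of total masses.
   Context: Let $\mathcal A^+$ be the set of non-empty finite words over $\mathcal A$, $|u|$ the length of $u$, $|u|_i$ the number of occurrences of $i$ in $u$, $\psi(u)=(|u|_1,\dots,|u|_d)^T$, and $u_{[1,m]}=u_1\cdots u_m$ (empty if $m=0$). A random substitution $\vartheta_{\mathbf P}=(\vartheta,\mathbf P)$ is a map $\vartheta$ assigning to each letter $i$ a non-empty finite set $\vartheta(i)\subset\mathcal A^+$ together with probability vectors $p_i\colon\vartheta(i)\to(0,1]$, $\sum_{v\in\vartheta(i)}p_i(v)=1$. For a word $u=u_1\cdots u_n$, $\vartheta_{\mathbf P}(u)$ is the random word obtained by independently replacing each letter $u_k$ by $v\in\vartheta(u_k)$ with probability $p_{u_k}(v)$ and concatenating in order; $(\vartheta_{\mathbf P}^n(u))_{n\ge0}$ is the Markov chain on $\mathcal A^+$ started at $u$ with these transition probabilities, and $\mathbb E$ is the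 corresponding expectation. It is compatible if $\psi(u)=\psi(v)$ for all $a\in\mathcal A$, $u,v\in\vartheta(a)$; then all realisations of $\vartheta_{\mathbf P}^n(v)$ have a common length $|\vartheta^n(v)|$, and the substitution matrix is $M_{i,j}=|v|_i$ for any $v\in\vartheta(j)$. It is primitive if $M$ is primitive with Perron–Frobenius eigenvalue $\lambda>1$. A compatible primitive random substitution is irreducible Pisot if $\lambda$ is a Pisot number and the characteristic polynomial of $M$ is irreducible over $\mathbb Z$. $\mathbf L,\mathbf R$ are left and right Perron–Frobenius eigenvectors of $M$ with $\|\mathbf R\|_1=1=\mathbf L^T\mathbf R$; $\mathbb H\subset\mathbb R^d$ is the hyperplane orthogonal to $\mathbf L$; $\pi$ is the linear projection along $\mathbf R$ onto $\mathbb H$. For a finite word $w$ and $a\in\mathcal A$, $\mu_a(w)=\sum_{0\le m\le|w|-1,\ w_{m+1}=a}\delta_{\pi(\psi(w_{[1,m]}))}$, a measure on $\mathbb H$. For a random word $w$, $\mu_a(w)$ is a random measure and $\mathbb E[\mu_a(w)]$ is the averaged measure. *)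

theory Defs
  imports
    "HOL-Probability.Probability"
    "HOL-Computational_Algebra.Computational_Algebra"
begin

section \<open>Random substitutions\<close>

text \<open>
  The alphabet \<open>{1,...,d}\<close> is rendered as a finite type \<open>'d\<close>, so that \<open>real ^ 'd\<close> is the
  \<open>d\<close>-dimensional Euclidean space.  A random substitution is a map \<open>\<theta> :: 'd \<Rightarrow> 'd list pmf\<close>:
  the set of possible images of the letter \<open>i\<close> is \<open>set_pmf (\<theta> i)\<close>, and \<open>pmf (\<theta> i)\<close> is
  the probability vector, which is strictly positive on that set and sums to one.
\<close>

definition random_substitution :: "('d::finite \<Rightarrow> 'd list pmf) \<Rightarrow> bool" where
  "random_substitution \<theta> \<longleftrightarrow> (\<forall>i. finite (set_pmf (\<theta> i)) \<and> [] \<notin> set_pmf (\<theta> i))"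

primrec subst_word :: "('d::finite \<Rightarrow> 'd list pmf) \<Rightarrow> 'd list \<Rightarrow> 'd list pmf" where
  "subst_word \<theta> [] = return_pmf []"
| "subst_word \<theta> (i # u) =
     bind_pmf (\<theta> i) (\<lambda>v. bind_pmf (subst_word \<theta> u) (\<lambda>w. return_pmf (v @ w)))"

text \<open>The law of the \<open>n\<close>-th step of the Markov chain on words started at \<open>u\<close>.\<close>

primrec subst_iter :: "('d::finite \<Rightarrow> 'd list pmf) \<Rightarrow> nat \<Rightarrow> 'd list \<Rightarrow> 'd list pmf" where
  "subst_iter \<theta> 0 u = return_pmf u"
| "subst_iter \<theta> (Suc n) u = bind_pmf (subst_iter \<theta> n u) (subst_word \<theta>)"

definition abelianise :: "'d::finite list \<Rightarrow> real ^ 'd" where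
  "abelianise u = (\<chi> i. real (count_list u i))"

definition compatible :: "('d::finite \<Rightarrow> 'd list pmf) \<Rightarrow> bool" where
  "compatible \<theta> \<longleftrightarrow>
     (\<forall>a. \<forall>u\<in>set_pmf (\<theta> a). \<forall>v\<in>set_pmf (\<theta> a). abelianise u = abelianise v)"

text \<open>
  For compatible \<open>\<theta>\<close> the following two quantities do not depend on the chosen realisation.
\<close>

definition iter_length :: "('d::finite \<Rightarrow> 'd list pmf) \<Rightarrow> nat \<Rightarrow> 'd list \<Rightarrow> nat" where
  "iter_length \<theta> n v = length (SOME w. w \<in> set_pmf (subst_iter \<theta> n v))"

definition subst_matrix :: "('d::finite \<Rightarrow> 'd list pmf) \<Rightarrow> int ^ 'd ^ 'd" where
  "subst_matrix \<theta> = (\<chi> i j. int (count_list (SOME v. v \<in> set_pmf (\<theta> j)) i))"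


section \<open>Primitivity and the Pisot property\<close>

definition matrix_power :: "'a::semiring_1 ^ 'd ^ 'd \<Rightarrow> nat \<Rightarrow> 'a ^ 'd ^ 'd::finite" where
  "matrix_power A k = (((**) A) ^^ k) (mat 1)"

definition primitive_matrix :: "int ^ 'd ^ 'd::finite \<Rightarrow> bool" where
  "primitive_matrix A \<longleftrightarrow>
     (\<forall>i j. A $ i $ j \<ge> 0) \<and> (\<exists>k\<ge>1. \<forall>i j. matrix_power A k $ i $ j > 0)"

definition eigenvalues :: "int ^ 'd ^ 'd::finite \<Rightarrow> complex set" where
  "eigenvalues A = {z. \<exists>x::complex ^ 'd. x \<noteq> 0 \<and> map_matrix of_int A *v x = z *s x}"

text \<open>The Perron--Frobenius eigenvalue of a primitive matrix is its spectral radius.\<close>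

definition PF_eigenvalue :: "int ^ 'd ^ 'd::finite \<Rightarrow> real" where
  "PF_eigenvalue A = Max (cmod ` eigenvalues A)"

definition primitive_subst :: "('d::finite \<Rightarrow> 'd list pmf) \<Rightarrow> bool" where
  "primitive_subst \<theta> \<longleftrightarrow>
     primitive_matrix (subst_matrix \<theta>) \<and> PF_eigenvalue (subst_matrix \<theta>) > 1"

definition characteristic_poly :: "int ^ 'd ^ 'd::finite \<Rightarrow> int poly" where
  "characteristic_poly A = det (\<chi> i j. (if i = j then [:0, 1:] else 0) - [:A $ i $ j:])"

text \<open>
  By Gauss' lemma a monic irreducible integer polynomial with root \<open>x\<close> is the minimal polynomial
  of \<open>x\<close>, so its complex roots are exactly the Galois conjugates of \<open>x\<close>.
\<close>

definition pisot_number :: "real \<Rightarrow> bool" where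
  "pisot_number x \<longleftrightarrow> x > 1 \<and>
     (\<exists>p::int poly. lead_coeff p = 1 \<and> irreducible p \<and> poly (map_poly of_int p) x = 0 \<and>
        (\<forall>z::complex. poly (map_poly of_int p) z = 0 \<and> z \<noteq> of_real x \<longrightarrow> cmod z < 1))"

definition irreducible_pisot :: "('d::finite \<Rightarrow> 'd list pmf) \<Rightarrow> bool" where
  "irreducible_pisot \<theta> \<longleftrightarrow> compatible \<theta> \<and> primitive_subst \<theta> \<and>
     pisot_number (PF_eigenvalue (subst_matrix \<theta>)) \<and>
     irreducible (characteristic_poly (subst_matrix \<theta>))"

text \<open>As usual, Perron--Frobenius eigenvectors are taken with strictly positive entries.\<close>

definition right_PF_eigenvector :: "int ^ 'd ^ 'd::finite \<Rightarrow> real ^ 'd \<Rightarrow> bool" where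
  "right_PF_eigenvector A R \<longleftrightarrow>
     (\<forall>i. R $ i > 0) \<and> map_matrix of_int A *v R = PF_eigenvalue A *s R"

definition left_PF_eigenvector :: "int ^ 'd ^ 'd::finite \<Rightarrow> real ^ 'd \<Rightarrow> bool" where
  "left_PF_eigenvector A L \<longleftrightarrow>
     (\<forall>i. L $ i > 0) \<and> L v* map_matrix of_int A = PF_eigenvalue A *s L"


section \<open>Projection to the hyperplane and empirical measures\<close>

definition hyperplane :: "real ^ 'd::finite \<Rightarrow> (real ^ 'd) set" where
  "hyperplane L = {x. L \<bullet> x = 0}"

definition proj :: "real ^ 'd::finite \<Rightarrow> real ^ 'd \<Rightarrow> real ^ 'd \<Rightarrow> real ^ 'd" where
  "proj L R x = x - ((L \<bullet> x) / (L \<bullet> R)) *\<^sub>R R"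

lemma proj_is_projection_along:
  assumes "L \<bullet> R \<noteq> 0"
  shows "linear (proj L R)" "proj L R R = 0"
    "proj L R x \<in> hyperplane L" "x \<in> hyperplane L \<Longrightarrow> proj L R x = x"
proof -
  show "linear (proj L R)"
    unfolding proj_def
    by (rule linearI) (simp_all add: inner_add_right add_divide_distrib algebra_simps)
qed (use assms in \<open>simp_all add: proj_def hyperplane_def inner_diff_right\<close>)

abbreviation hyperplane_borel :: "real ^ 'd::finite \<Rightarrow> (real ^ 'd) measure" where
  "hyperplane_borel L \<equiv> restrict_space borel (hyperplane L)"

text \<open>
  A sum of Dirac measures; \<open>w ! m\<close> is the \<open>(m+1)\<close>-st letter of \<open>w\<close>, as lists are indexed from 0.
\<close>

definition letter_measure ::
    "real ^ 'd::finite \<Rightarrow> real ^ 'd \<Rightarrow> 'd \<Rightarrow> 'd list \<Rightarrow> (real ^ 'd) measure" where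
  "letter_measure L R a w =
     measure_of (hyperplane L) (sets (hyperplane_borel L))
       (\<lambda>B. \<Sum>m | m < length w \<and> w ! m = a.
          emeasure (return (hyperplane_borel L) (proj L R (abelianise (take m w)))) B)"

text \<open>The measure \<open>B \<mapsto> E[\<mu>\<^sub>a(w)(B)]\<close> for a random word \<open>w\<close> with law \<open>W\<close>.\<close>

definition averaged_measure ::
    "real ^ 'd::finite \<Rightarrow> real ^ 'd \<Rightarrow> 'd \<Rightarrow> 'd list pmf \<Rightarrow> (real ^ 'd) measure" where
  "averaged_measure L R a W =
     measure_of (hyperplane L) (sets (hyperplane_borel L))
       (\<lambda>B. \<integral>\<^sup>+ w. emeasure (letter_measure L R a w) B \<partial>measure_pmf W)"

lemma sets_letter_measure [simp]: "sets (letter_measure L R a w) = sets (hyperplane_borel L)"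
  unfolding letter_measure_def
  using sets.sets_measure_of_eq[of "hyperplane_borel L"] by (simp add: space_restrict_space)

text \<open>The set functions above are countably additive, so \<open>measure_of\<close> does not degenerate.\<close>

lemma emeasure_letter_measure:
  assumes B: "B \<in> sets (hyperplane_borel L)"
  shows "emeasure (letter_measure L R a w) B =
    (\<Sum>m | m < length w \<and> w ! m = a.
       emeasure (return (hyperplane_borel L) (proj L R (abelianise (take m w)))) B)"
proof (rule emeasure_measure_of[OF letter_measure_def])
  show "sets (hyperplane_borel L) \<subseteq> Pow (hyperplane L)"
    using sets.sets_into_space[of _ "hyperplane_borel L"] by (auto simp: space_restrict_space)
  show "countably_additive (sets (letter_measure L R a w))
    (\<lambda>B. \<Sum>m | m < length w \<and> w ! m = a.
       emeasure (return (hyperplane_borel L) (proj L R (abelianise (take m w)))) B)"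
    unfolding countably_additive_def sets_letter_measure
    by (intro allI impI) (subst suminf_sum, auto intro!: sum.cong suminf_emeasure simp del: emeasure_return)
qed (use B in \<open>auto simp: positive_def\<close>)

lemma sets_averaged_measure [simp]: "sets (averaged_measure L R a W) = sets (hyperplane_borel L)"
  unfolding averaged_measure_def
  using sets.sets_measure_of_eq[of "hyperplane_borel L"] by (simp add: space_restrict_space)

lemma emeasure_averaged_measure:
  assumes B: "B \<in> sets (hyperplane_borel L)"
  shows "emeasure (averaged_measure L R a W) B =
    (\<integral>\<^sup>+ w. emeasure (letter_measure L R a w) B \<partial>measure_pmf W)"
proof (rule emeasure_measure_of[OF averaged_measure_def])
  show "sets (hyperplane_borel L) \<subseteq> Pow (hyperplane L)"
    using sets.sets_into_space[of _ "hyperplane_borel L"] by (auto simp: space_restrict_space)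
  show "countably_additive (sets (averaged_measure L R a W))
    (\<lambda>B. \<integral>\<^sup>+ w. emeasure (letter_measure L R a w) B \<partial>measure_pmf W)"
    unfolding countably_additive_def sets_averaged_measure
    by (intro allI impI)
      (subst nn_integral_suminf[symmetric], auto intro!: nn_integral_cong suminf_emeasure)
qed (use B in \<open>auto simp: positive_def\<close>)

text \<open>
  Weak convergence of finite Borel measures on \<open>S\<close>, tested against all bounded continuous
  functions on \<open>S\<close>.  (The library's \<open>weak_conv_m\<close> only covers measures on the real line.)
\<close>

definition weakly_converges_on ::
    "'b::topological_space set \<Rightarrow> (nat \<Rightarrow> 'b measure) \<Rightarrow> 'b measure \<Rightarrow> bool" where
  "weakly_converges_on S N M \<longleftrightarrow>
     (\<forall>f::'b \<Rightarrow> real. continuous_on S f \<and> bounded (f ` S) \<longrightarrow>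
        (\<lambda>n. \<integral>x. f x \<partial>N n) \<longlonglongrightarrow> (\<integral>x. f x \<partial>M))"

end

theory Submission
  imports Defs
begin

text \<open>
  Fix a bounded continuous function \<open>f\<close> and a starting word \<open>v\<close>, and let \<open>E n a f\<close> be the expected
  sum of \<open>f\<close> over the points of the letter \<open>a\<close> in the \<open>n\<close>-th random iterate of \<open>v\<close>. Sorting the
  letters of the iterate \<open>n + 1\<close> by the letter that produced them gives a recursion
  (\<open>expected_sum_Suc\<close>)
  \<open>E (n + 1) a f = (\<Sum>e. p\<^sub>e * E n j\<^sub>e (f \<circ> T\<^sub>e))\<close>, where \<open>T\<^sub>e x = c\<^sub>e + M x\<close>,
  over finitely many edges \<open>e\<close>: occurrences of \<open>a\<close> in images of letters \<open>j\<^sub>e\<close>, of probability \<open>p\<^sub>e\<close>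
  and with prefix point \<open>c\<^sub>e\<close>. Two facts turn this recursion into convergence.

  First, \<open>M\<close> contracts the hyperplane in a suitable norm (\<open>adapted_norm_contraction\<close>). The
  characteristic polynomial is irreducible and has the Pisot number \<open>lam\<close> as a root, so all other
  eigenvalues are conjugates of \<open>lam\<close> and lie in the open unit disc, while by Perron--Frobenius the
  eigenvectors for \<open>lam\<close> miss the hyperplane (\<open>spectrum_H\<close>).

  Second, since \<open>R\<close> is an eigenvector, the numbers \<open>p\<^sub>e R\<^sub>j / (lam R\<^sub>a)\<close>, with \<open>j\<close> the source of
  \<open>e\<close>, are the transition probabilities of a Markov chain on letters. Following this chain from
  \<open>a\<close> forever produces a random series of offsets \<open>c\<^sub>e\<close>, the \<open>k\<close>-th one multiplied by the \<open>k\<close>-th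
  power of \<open>M\<close>. It converges almost surely by the contraction, and the limit measure for \<open>a\<close> is
  \<open>R\<^sub>a\<close> times the law of its sum.

  To compare the two, unroll the recursion \<open>n\<close> times, starting with the words at time \<open>k\<close>. The
  composition of \<open>n\<close> maps \<open>T\<^sub>e\<close> shrinks all points to almost the same point, so that only the
  numbers of letters at time \<open>k\<close> matter, and these are asymptotic to \<open>lam\<^sup>k (L \<bullet> \<psi>(v)) R\<close>. Thus
  \<open>E (n + k) a f\<close> is close to \<open>lam\<^sup>n\<^sup>+\<^sup>k (L \<bullet> \<psi>(v)) R\<^sub>a\<close> times the mean of \<open>f\<close> at the \<open>n\<close>-th partial
  sum of the series (\<open>expected_sum_near_path_mean\<close>). The length of the iterate \<open>n\<close> is asymptotic to
  \<open>lam\<^sup>n (L \<bullet> \<psi>(v))\<close>, which makes the quotient independent of \<open>v\<close>.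
\<close>

section \<open>Integer polynomials with a common root\<close>

abbreviation int_eval :: "int poly \<Rightarrow> 'a::comm_ring_1 \<Rightarrow> 'a" where
  "int_eval p x \<equiv> poly (map_poly of_int p) x"

lemma int_eval_pCons: "int_eval (pCons a p) x = of_int a + x * int_eval p x"
  by (simp add: map_poly_pCons)

lemma int_eval_add: "int_eval (p + q) x = int_eval p x + int_eval q x"
proof (induction p q rule: poly_induct2)
  case (pCons a p b q)
  then show ?case by (simp add: int_eval_pCons algebra_simps del: add_pCons) (simp add: int_eval_pCons algebra_simps)
qed auto

lemma int_eval_smult: "int_eval (smult c p) x = of_int c * int_eval p x"
  by (induction p) (simp_all add: int_eval_pCons algebra_simps)

lemma int_eval_mult: "int_eval (p * q) x = int_eval p x * int_eval q x"
  by (induction p) (simp_all add: int_eval_add int_eval_smult int_eval_pCons algebra_simps)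

lemma int_eval_sum: "int_eval (\<Sum>i\<in>A. f i) x = (\<Sum>i\<in>A. int_eval (f i) x)"
  by (induction A rule: infinite_finite_induct) (simp_all add: int_eval_add)

lemma int_eval_prod: "int_eval (\<Prod>i\<in>A. f i) x = (\<Prod>i\<in>A. int_eval (f i) x)"
  by (induction A rule: infinite_finite_induct) (simp_all add: int_eval_mult)

lemma int_eval_of_int: "int_eval (of_int c) x = of_int c"
  by (simp add: of_int_poly int_eval_pCons)

text \<open>
  A form of Gauss' lemma: over the integers an irreducible polynomial divides
  every polynomial with which it shares a root. Take \<open>m\<close> of least degree among the nonzero
  polynomials with root \<open>x\<close>. Pseudo-division makes every polynomial with root \<open>x\<close> a multiple of
  \<open>m\<close> after scaling by a nonzero integer. An irreducible element of the factorial ring of integer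
  polynomials is prime, and a nonconstant prime cannot divide the scaling integers; so \<open>p\<close> divides
  \<open>m\<close> and, in turn, \<open>f\<close>.
\<close>
lemma irreducible_int_poly_dvd:
  fixes p f :: "int poly" and x :: "'a::field_char_0"
  assumes p: "irreducible p" "int_eval p x = 0" and f: "int_eval f x = 0"
  shows "p dvd f"
proof -
  have root: "degree h > 0" if "h \<noteq> 0" "int_eval h x = 0" for h :: "int poly"
  proof (rule ccontr)
    assume "\<not> degree h > 0"
    then obtain c where "h = [:c:]" by (auto elim: degree_eq_zeroE)
    with that show False by (simp add: int_eval_pCons)
  qed
  have "p \<noteq> 0" using p by auto
  obtain m where m: "m \<noteq> 0" "int_eval m x = 0"
    and min: "\<And>h. h \<noteq> 0 \<Longrightarrow> int_eval h x = 0 \<Longrightarrow> degree m \<le> degree h"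
    using ex_has_least_nat[of "\<lambda>h. h \<noteq> 0 \<and> int_eval h x = 0" p degree] p \<open>p \<noteq> 0\<close> by blast
  have mult: "\<exists>c q. c \<noteq> 0 \<and> smult c h = m * q" if h: "int_eval h x = 0" for h
  proof -
    obtain c q where c: "c \<noteq> 0" "smult c h = m * q + pseudo_mod h m"
      using pseudo_mod(1)[OF m(1)] by blast
    have "int_eval (pseudo_mod h m) x = 0"
      using arg_cong[OF c(2), of "\<lambda>h. int_eval h x"] h m(2)
      by (simp add: int_eval_add int_eval_mult int_eval_smult)
    then have "pseudo_mod h m = 0"
      using min[of "pseudo_mod h m"] pseudo_mod(2)[OF m(1), of h] by linarith
    with c show ?thesis by auto
  qed
  have prime: "prime_elem p" using p(1) by (rule irreducible_imp_prime_elem)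
  have ndvd: "\<not> p dvd [:c:]" if "c \<noteq> 0" for c
  proof
    assume "p dvd [:c:]"
    then have "degree p \<le> 0" using dvd_imp_degree_le[of p "[:c:]"] that by simp
    with root[OF \<open>p \<noteq> 0\<close> p(2)] show False by simp
  qed
  obtain c q where c: "c \<noteq> 0" "smult c p = m * q" using mult[OF p(2)] by blast
  have "p dvd m * q" using c(2) by (metis dvd_refl dvd_smult)
  then have "p dvd m"
  proof (rule prime_elem_dvd_multD[OF prime, THEN disjE])
    assume "p dvd q"
    then obtain s where "q = p * s" by (auto elim: dvdE)
    with c(2) have "p * [:c:] = p * (m * s)" by (simp add: algebra_simps)
    with \<open>p \<noteq> 0\<close> have "[:c:] = m * s" by (metis mult_cancel_left)
    then have "int_eval [:c:] x = 0" using m(2) by (simp only: int_eval_mult) simp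
    with c(1) show ?thesis by (simp add: int_eval_pCons)
  qed
  obtain c' q' where c': "c' \<noteq> 0" "smult c' f = m * q'" using mult[OF f] by blast
  then have "p dvd [:c':] * f" using \<open>p dvd m\<close> by simp
  then show ?thesis using prime_elem_dvd_multD[OF prime] ndvd[OF c'(1)] by blast
qed

text \<open>
  The roots of \<open>f\<close> are conjugates of \<open>x\<close>, because \<open>f\<close> divides the polynomial that witnesses the
  Pisot property.
\<close>
lemma pisot_conjugate_bound:
  assumes "pisot_number x" "irreducible f" "int_eval f x = 0" "int_eval f z = 0" "z \<noteq> of_real x"
  shows "cmod z < 1"
proof -
  obtain p :: "int poly" where p: "int_eval p x = 0"
    and bound: "\<And>z::complex. int_eval p z = 0 \<Longrightarrow> z \<noteq> of_real x \<Longrightarrow> cmod z < 1"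
    using assms(1) unfolding pisot_number_def by blast
  have "f dvd p" using irreducible_int_poly_dvd assms p by blast
  then have "int_eval p z = 0" using assms(4) by (auto simp: int_eval_mult elim!: dvdE)
  then show ?thesis using bound assms by blast
qed

lemma int_eval_characteristic_poly:
  fixes x :: "'a::comm_ring_1"
  shows "int_eval (characteristic_poly A) x = det (mat x - map_matrix of_int A)"
  unfolding characteristic_poly_def det_def int_eval_sum int_eval_mult int_eval_prod int_eval_of_int
proof (intro sum.cong refl arg_cong2[where f = "(*)"] prod.cong)
  fix p :: "'b \<Rightarrow> 'b" and i
  show "int_eval ((\<chi> i j. (if i = j then [:0, 1:] else 0) - [:A $ i $ j:]) $ i $ p i) x
    = (mat x - map_matrix of_int A) $ i $ p i"
    by (simp add: mat_def int_eval_pCons)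
qed

lemma eigenvector_imp_root_characteristic_poly:
  fixes x :: "'a::field ^ 'd::finite"
  assumes "map_matrix of_int A *v x = z *s x" "x \<noteq> 0"
  shows "int_eval (characteristic_poly A) z = 0"
proof -
  have "mat z *v x = z *s x"
    by (simp add: vec_eq_iff matrix_vector_mult_def mat_def if_distrib[of "\<lambda>a. a * _"] cong: if_cong)
  then have "(mat z - map_matrix of_int A) *v x = 0"
    using assms(1) by (simp add: matrix_vector_mult_diff_rdistrib)
  then have "\<not> invertible (mat z - map_matrix of_int A)"
    using assms(2) by (auto simp: invertible_left_inverse matrix_left_invertible_ker)
  then show ?thesis by (simp add: int_eval_characteristic_poly invertible_det_nz)
qed

lemma funpow_linear:
  fixes T :: "'a::comm_ring_1 ^ 'd \<Rightarrow> 'a ^ 'd"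
  assumes "\<And>x y. T (x - y) = T x - T y" "\<And>c x. T (c *s x) = c *s T x"
  shows "(T ^^ i) (x - y) = (T ^^ i) x - (T ^^ i) y" "(T ^^ i) (c *s x) = c *s (T ^^ i) x"
  by (induction i) (simp_all add: assms)

section \<open>Summable iterates of a linear map\<close>

definition poly_act :: "('a::comm_ring_1 ^ 'd \<Rightarrow> 'a ^ 'd) \<Rightarrow> 'a poly \<Rightarrow> 'a ^ 'd \<Rightarrow> 'a ^ 'd" where
  "poly_act T p v = (\<Sum>i\<le>degree p. coeff p i *s (T ^^ i) v)"

lemma poly_act_eq: "degree p \<le> n \<Longrightarrow> poly_act T p v = (\<Sum>i\<le>n. coeff p i *s (T ^^ i) v)"
  unfolding poly_act_def by (rule sum.mono_neutral_left) (auto simp: coeff_eq_0)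

lemma poly_act_linear_factor:
  assumes T: "\<And>x y. T (x - y) = T x - T y" "\<And>c x. T (c *s x) = c *s T x"
  shows "poly_act T ([:- z, 1:] * q) v = poly_act T q (T v - z *s v)"
proof -
  let ?n = "degree q"
  note pow = funpow_linear[of T, OF T]
  have *: "[:- z, 1:] * q = pCons 0 q - smult z q" by simp
  have deg: "degree ([:- z, 1:] * q) \<le> Suc ?n"
    unfolding * by (intro degree_diff_le degree_pCons_le) (use degree_smult_le[of z q] in auto)
  have "poly_act T ([:- z, 1:] * q) v = (\<Sum>i\<le>Suc ?n. coeff (pCons 0 q - smult z q) i *s (T ^^ i) v)"
    by (subst poly_act_eq[OF deg]) (simp add: *)
  also have "\<dots> = (\<Sum>i\<le>Suc ?n. coeff (pCons 0 q) i *s (T ^^ i) v)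
      - (\<Sum>i\<le>Suc ?n. (z * coeff q i) *s (T ^^ i) v)"
    by (simp add: sum_subtractf vector_sub_rdistrib del: sum.atMost_Suc)
  also have "(\<Sum>i\<le>Suc ?n. coeff (pCons 0 q) i *s (T ^^ i) v) = (\<Sum>i\<le>?n. coeff q i *s (T ^^ Suc i) v)"
    by (subst sum.atMost_Suc_shift) simp
  also have "(\<Sum>i\<le>Suc ?n. (z * coeff q i) *s (T ^^ i) v) = (\<Sum>i\<le>?n. (z * coeff q i) *s (T ^^ i) v)"
    by (simp add: coeff_eq_0)
  also have "(\<Sum>i\<le>?n. coeff q i *s (T ^^ Suc i) v) - (\<Sum>i\<le>?n. (z * coeff q i) *s (T ^^ i) v)
      = poly_act T q (T v - z *s v)"
    unfolding poly_act_def
    by (simp add: pow sum_subtractf[symmetric] vector_ssub_ldistrib funpow_swap1 mult.commute)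
  finally show ?thesis .
qed

lemma norm_vec_smult: "norm (z *s x) = cmod z * norm (x :: complex ^ 'd::finite)"
  by (simp add: norm_vec_def norm_mult L2_set_right_distrib)

text \<open>
  More vectors \<open>v, T v, T (T v), \<dots>\<close> than the dimension are linearly dependent; if two of them
  coincide, the difference of the two monomials serves.
\<close>
lemma exists_annihilating_poly:
  fixes T :: "complex ^ 'd::finite \<Rightarrow> complex ^ 'd"
  shows "\<exists>q. q \<noteq> 0 \<and> poly_act T q v = 0"
proof (cases "inj (\<lambda>i. (T ^^ i) v)")
  case False
  then obtain i' j' where ne: "i' \<noteq> j'" and eq: "(T ^^ i') v = (T ^^ j') v"
    unfolding inj_def by blast
  obtain i j where ij: "i < j" "(T ^^ i) v = (T ^^ j) v"
    using that[of i' j'] that[of j' i'] ne eq by (cases "i' < j'") auto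
  let ?q = "monom 1 i - monom 1 j :: complex poly"
  have "coeff ?q i \<noteq> 0" using ij by simp
  then have "?q \<noteq> 0" by (metis coeff_0)
  moreover have "poly_act T ?q v = (\<Sum>k\<le>j. coeff ?q k *s (T ^^ k) v)"
    by (rule poly_act_eq) (use ij in \<open>auto intro!: degree_diff_le degree_monom_le[THEN order_trans]\<close>)
  then have "poly_act T ?q v = 0" using ij
    by (simp add: vector_sub_rdistrib sum_subtractf if_distrib[of "\<lambda>a. a *s _"] cong: if_cong)
  ultimately show ?thesis by blast
next
  case True
  let ?D = "DIM(complex ^ 'd)" and ?S = "(\<lambda>i. (T ^^ i) v) ` {..DIM(complex ^ 'd)}"
  have inj: "inj_on (\<lambda>i. (T ^^ i) v) {..?D}" using True by (rule inj_on_subset) simp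
  have "dependent ?S" by (rule dependent_biggerset) (unfold card_image[OF inj], simp)
  then obtain u where u: "\<exists>w\<in>?S. u w \<noteq> 0" "(\<Sum>w\<in>?S. u w *\<^sub>R w) = 0"
    using dependent_finite[of ?S] by auto
  define q where "q = (\<Sum>i\<le>?D. monom (complex_of_real (u ((T ^^ i) v))) i)"
  have coeff: "coeff q k = (if k \<le> ?D then complex_of_real (u ((T ^^ k) v)) else 0)" for k
    by (simp add: q_def coeff_sum if_distrib cong: if_cong)
  have nz: "q \<noteq> 0" using u(1) coeff by (metis (no_types, lifting) coeff_0 imageE of_real_eq_0_iff atMost_iff)
  have "poly_act T q v = (\<Sum>k\<le>?D. coeff q k *s (T ^^ k) v)"
    by (rule poly_act_eq) (rule degree_le, simp add: coeff)
  also have "\<dots> = (\<Sum>k\<le>?D. u ((T ^^ k) v) *\<^sub>R (T ^^ k) v)"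
    by (rule sum.cong) (simp_all add: coeff vec_eq_iff scaleR_conv_of_real[where 'a = complex])
  also have "\<dots> = 0" using u(2) unfolding sum.reindex[OF inj] o_def .
  finally show ?thesis using nz by blast
qed

text \<open>
  Summing the recurrence bounds the partial sums \<open>s\<close> of \<open>a\<close> by \<open>s \<le> a 0 + c * s + suminf b\<close>.
\<close>
lemma summable_of_recurrence:
  fixes a b :: "nat \<Rightarrow> real"
  assumes "\<And>n. 0 \<le> a n" "\<And>n. 0 \<le> b n" "summable b" "0 \<le> c" "c < 1"
    and rec: "\<And>n. a (Suc n) \<le> c * a n + b n"
  shows "summable a"
proof (rule summableI_nonneg_bounded)
  fix n
  show "(\<Sum>k<n. a k) \<le> (a 0 + suminf b) / (1 - c)"
  proof (cases n)
    case 0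
    then show ?thesis using assms suminf_nonneg[OF assms(3)] by simp
  next
    case (Suc m)
    have "(\<Sum>k<n. a k) = a 0 + (\<Sum>k<m. a (Suc k))"
      unfolding Suc by (rule sum.lessThan_Suc_shift)
    also have "\<dots> \<le> a 0 + (c * (\<Sum>k<m. a k) + (\<Sum>k<m. b k))"
      using rec by (simp add: sum_distrib_left sum.distrib[symmetric] sum_mono)
    also have "(\<Sum>k<m. b k) \<le> suminf b" by (rule sum_le_suminf) (use assms in auto)
    also have "c * (\<Sum>k<m. a k) \<le> c * (\<Sum>k<n. a k)"
      using assms Suc by (intro mult_left_mono) auto
    finally have "(1 - c) * (\<Sum>k<n. a k) \<le> a 0 + suminf b" by (simp add: algebra_simps)
    then show ?thesis using assms by (simp add: field_simps)
  qed
qed (use assms in auto)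

text \<open>
  The subspace \<open>S\<close> is invariant and all eigenvalues of \<open>T\<close> on it lie in the open unit disc. A
  polynomial \<open>q\<close> that annihilates \<open>v\<close> splits into linear factors, and
  these are removed one at a time. A root \<open>z\<close> in the disc is handled by the recurrence
  \<open>T\<^sup>k\<^sup>+\<^sup>1 v = z T\<^sup>k v + T\<^sup>k (T v - z v)\<close>, since the remaining factors annihilate \<open>T v - z v\<close>. A root
  outside the disc is not an eigenvalue, so its factor acts injectively and may be cancelled.
\<close>
lemma summable_norm_iterates:
  fixes T :: "complex ^ 'd::finite \<Rightarrow> complex ^ 'd"
  assumes T: "\<And>x y. T (x - y) = T x - T y" "\<And>c x. T (c *s x) = c *s T x"
    and S: "\<And>x. x \<in> S \<Longrightarrow> T x \<in> S" "\<And>c x. x \<in> S \<Longrightarrow> c *s x \<in> S"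
      "\<And>x y. x \<in> S \<Longrightarrow> y \<in> S \<Longrightarrow> x - y \<in> S"
    and spec: "\<And>x z. x \<in> S \<Longrightarrow> x \<noteq> 0 \<Longrightarrow> T x = z *s x \<Longrightarrow> cmod z < 1"
    and "v \<in> S"
  shows "summable (\<lambda>k. norm ((T ^^ k) v))"
proof -
  note pow = funpow_linear[of T, OF T]
  have act: "poly_act T q (x - y) = poly_act T q x - poly_act T q y"
    "poly_act T q (c *s x) = c *s poly_act T q x" "T (poly_act T q x) = poly_act T q (T x)" for q x y c
  proof -
    have 0: "T 0 = 0" using T(1)[of 0 0] by simp
    have add: "T (x + y) = T x + T y" for x y using T(1)[of x "0 - y"] T(1)[of 0 y] 0 by simp
    have sum: "T (\<Sum>i\<in>A. f i) = (\<Sum>i\<in>A. T (f i))" for A :: "nat set" and f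
      by (induction A rule: infinite_finite_induct) (simp_all add: 0 add)
    show "poly_act T q (x - y) = poly_act T q x - poly_act T q y"
      by (simp add: poly_act_def pow vector_ssub_ldistrib sum_subtractf)
    show "poly_act T q (c *s x) = c *s poly_act T q x"
      by (simp add: poly_act_def pow vec_eq_iff sum_distrib_left mult.left_commute mult.assoc)
    show "T (poly_act T q x) = poly_act T q (T x)"
      by (simp add: poly_act_def sum T funpow_swap1)
  qed
  have inS: "poly_act T q x \<in> S" if "x \<in> S" for q x
  proof -
    have p: "(T ^^ i) x \<in> S" for i by (induction i) (use that S in auto)
    have 0: "0 \<in> S" using S(3)[OF that that] by simp
    have add: "x + y \<in> S" if "x \<in> S" "y \<in> S" for x y
      using S(3)[OF that(1) S(3)[OF 0 that(2)]] by simp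
    have "(\<Sum>i\<in>A. coeff q i *s (T ^^ i) x) \<in> S" for A
      by (induction A rule: infinite_finite_induct) (use 0 add p S in auto)
    then show ?thesis by (simp add: poly_act_def)
  qed
  have main: "summable (\<lambda>k. norm ((T ^^ k) v))"
    if "v \<in> S" "q \<noteq> 0" "poly_act T q v = 0" for q v
    using that
  proof (induction "degree q" arbitrary: q v)
    case 0
    then obtain c where "q = [:c:]" "c \<noteq> 0" by (metis degree_eq_zeroE pCons_0_0)
    with 0 have "v = 0" by (simp add: poly_act_def)
    then have "(T ^^ k) v = 0" for k using pow(1)[of k 0 0] by simp
    then show ?case by simp
  next
    case (Suc n)
    have "\<not> constant (poly q)" using Suc.hyps(2) by (simp add: constant_degree)
    then obtain z where "poly q z = 0" using fundamental_theorem_of_algebra by blast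
    then obtain q' where q': "q = [:- z, 1:] * q'" by (auto simp: poly_eq_0_iff_dvd elim: dvdE)
    then have "q' \<noteq> 0" using Suc.prems by auto
    then have deg: "n = degree q'" using Suc.hyps(2) unfolding q' by (subst (asm) degree_mult_eq) auto
    have zero: "poly_act T q' (T v - z *s v) = 0"
      using Suc.prems(3) unfolding q' poly_act_linear_factor[OF T] .
    show ?case
    proof (cases "cmod z < 1")
      case True
      have sum: "summable (\<lambda>k. norm ((T ^^ k) (T v - z *s v)))"
        by (rule Suc.hyps(1)[OF deg]) (use S Suc.prems \<open>q' \<noteq> 0\<close> zero in auto)
      have rec: "norm ((T ^^ Suc k) v) \<le> cmod z * norm ((T ^^ k) v) + norm ((T ^^ k) (T v - z *s v))" for k
      proof -
        have "(T ^^ Suc k) v = z *s (T ^^ k) v + (T ^^ k) (T v - z *s v)"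
          by (simp add: pow funpow_swap1)
        then show ?thesis by (metis norm_triangle_ineq norm_vec_smult)
      qed
      show ?thesis
        by (rule summable_of_recurrence[OF norm_ge_zero norm_ge_zero sum norm_ge_zero True rec])
    next
      case False
      have "T (poly_act T q' v) = z *s poly_act T q' v"
        using zero by (simp add: act)
      then have "poly_act T q' v = 0" using spec[OF inS[OF Suc.prems(1)]] False by blast
      then show ?thesis using Suc.hyps(1)[OF deg] Suc.prems \<open>q' \<noteq> 0\<close> by blast
    qed
  qed
  obtain q where "q \<noteq> 0" "poly_act T q v = 0" using exists_annihilating_poly by blast
  then show ?thesis using main assms by blast
qed

section \<open>A Pisot matrix contracts the hyperplane\<close>

lemma map_matrix_of_int_mult:
  "map_matrix of_int (A ** B) = map_matrix of_int A ** (map_matrix of_int B :: 'a::comm_ring_1 ^ 'd ^ 'd::finite)"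
  by (simp add: vec_eq_iff matrix_matrix_mult_def)

lemma map_matrix_of_int_power:
  "map_matrix of_int (matrix_power A k) *v (x :: 'a::comm_ring_1 ^ 'd::finite) = ((\<lambda>x. map_matrix of_int A *v x) ^^ k) x"
proof (induction k)
  case 0
  have "map_matrix of_int (mat 1) = (mat 1 :: 'a ^ 'd ^ 'd)" by (simp add: vec_eq_iff mat_def)
  then show ?case by (simp add: matrix_power_def)
next
  case (Suc k)
  then show ?case
    by (simp add: matrix_power_def map_matrix_of_int_mult flip: matrix_vector_mul_assoc)
qed

lemma matrix_vector_mult_Re_Im:
  fixes x :: "complex ^ 'd::finite" and A :: "int ^ 'd ^ 'd"
  shows "map_matrix of_int A *v (\<chi> i. Re (x $ i)) = (\<chi> i. Re ((map_matrix of_int A *v x) $ i))"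
    and "map_matrix of_int A *v (\<chi> i. Im (x $ i)) = (\<chi> i. Im ((map_matrix of_int A *v x) $ i))"
  by (simp_all add: vec_eq_iff matrix_vector_mult_def)

locale pisot_substitution =
  fixes \<theta> :: "'d::finite \<Rightarrow> 'd list pmf" and L R :: "real ^ 'd"
  assumes rs: "random_substitution \<theta>" and compat: "compatible \<theta>" and pisot: "irreducible_pisot \<theta>"
    and left: "left_PF_eigenvector (subst_matrix \<theta>) L"
    and right: "right_PF_eigenvector (subst_matrix \<theta>) R"
    and sum_R: "(\<Sum>i\<in>UNIV. \<bar>R $ i\<bar>) = 1" and LR: "L \<bullet> R = 1"
begin

definition lam :: real where "lam = PF_eigenvalue (subst_matrix \<theta>)"

definition M :: "real ^ 'd ^ 'd" where "M = map_matrix of_int (subst_matrix \<theta>)"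

abbreviation M_power :: "nat \<Rightarrow> real ^ 'd \<Rightarrow> real ^ 'd" where
  "M_power k \<equiv> (\<lambda>x. M *v x) ^^ k"

definition H :: "(real ^ 'd) set" where "H = hyperplane L"

lemma lam_gt_1: "lam > 1"
  using pisot unfolding irreducible_pisot_def primitive_subst_def lam_def by blast

lemma R_pos: "R $ i > 0" and L_pos: "L $ i > 0"
  using left right unfolding left_PF_eigenvector_def right_PF_eigenvector_def by blast+

lemma M_R: "M *v R = lam *\<^sub>R R"
  using right unfolding right_PF_eigenvector_def M_def lam_def by (simp add: scalar_mult_eq_scaleR)

lemma inner_L_M: "L \<bullet> (M *v x) = lam * (L \<bullet> x)"
proof -
  have "L v* M = lam *\<^sub>R L"
    using left unfolding left_PF_eigenvector_def M_def lam_def by (simp add: scalar_mult_eq_scaleR)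
  then show ?thesis by (metis dot_lmul_matrix inner_scaleR_left)
qed

lemma H_iff: "x \<in> H \<longleftrightarrow> L \<bullet> x = 0" by (simp add: H_def hyperplane_def)

lemma H_closed: "0 \<in> H" "x \<in> H \<Longrightarrow> y \<in> H \<Longrightarrow> x + y \<in> H" "x \<in> H \<Longrightarrow> c *\<^sub>R x \<in> H"
  "x \<in> H \<Longrightarrow> y \<in> H \<Longrightarrow> x - y \<in> H" "x \<in> H \<Longrightarrow> M *v x \<in> H"
  by (simp_all add: H_iff inner_add_right inner_diff_right inner_L_M)

lemma closed_H: "closed H"
  unfolding H_def hyperplane_def by (rule closed_hyperplane)

text \<open>
  Perron--Frobenius argument: \<open>y = s R - x\<close>, with \<open>s\<close> the largest ratio of the entries, is a
  nonnegative eigenvector with a zero entry. A power of the matrix has positive entries only, which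
  forces \<open>y = 0\<close>, and the hyperplane contains no nonzero multiple of \<open>R\<close>.
\<close>
lemma PF_eigenspace_inter_H:
  assumes "x \<in> H" "M *v x = lam *\<^sub>R x"
  shows "x = 0"
proof -
  obtain k where k: "\<And>i j. matrix_power (subst_matrix \<theta>) k $ i $ j > 0"
    using pisot unfolding irreducible_pisot_def primitive_subst_def primitive_matrix_def by blast
  let ?P = "map_matrix of_int (matrix_power (subst_matrix \<theta>) k) :: real ^ 'd ^ 'd"
  define s where "s = Max (range (\<lambda>i. x $ i / R $ i))"
  have "s \<in> range (\<lambda>i. x $ i / R $ i)" unfolding s_def by (rule Max_in) auto
  then obtain i where i: "s = x $ i / R $ i" by auto
  have le: "x $ j / R $ j \<le> s" for j unfolding s_def by (rule Max_ge) auto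
  define y where "y = s *\<^sub>R R - x"
  have y_nonneg: "y $ j \<ge> 0" for j
    using le[of j] R_pos[of j] by (simp add: y_def field_simps)
  have y_i: "y $ i = 0" using R_pos[of i] by (simp add: y_def i)
  have "M *v y = lam *\<^sub>R y"
    by (simp add: y_def matrix_vector_mult_diff_distrib M_R assms(2) algebra_simps matrix_vector_mult_scaleR)
  then have "M_power n y = lam ^ n *\<^sub>R y" for n
    by (induction n) (simp_all add: matrix_vector_mult_scaleR)
  then have "?P *v y = lam ^ k *\<^sub>R y"
    by (simp add: map_matrix_of_int_power M_def)
  then have "(?P *v y) $ i = 0" using y_i by simp
  then have "(\<Sum>j\<in>UNIV. real_of_int (matrix_power (subst_matrix \<theta>) k $ i $ j) * y $ j) = 0"
    by (simp add: matrix_vector_mult_def)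
  then have "real_of_int (matrix_power (subst_matrix \<theta>) k $ i $ j) * y $ j = 0" for j
    using k[of i] y_nonneg by (subst (asm) sum_nonneg_eq_0_iff) (auto simp: less_imp_le)
  then have "y = 0" using k[of i] by (auto simp: vec_eq_iff) (metis less_irrefl)
  then have x: "x = s *\<^sub>R R" by (simp add: y_def)
  with assms(1) LR have "s = 0" by (simp add: H_iff)
  with x show "x = 0" by simp
qed

text \<open>
  This is where both algebraic hypotheses enter. An eigenvalue other than \<open>lam\<close> is a root of the
  irreducible characteristic polynomial, hence a conjugate of the Pisot number \<open>lam\<close>. For the
  eigenvalue \<open>lam\<close> itself the real and the imaginary part of the eigenvector vanish.
\<close>
lemma spectrum_H:
  fixes x :: "complex ^ 'd"
  assumes x: "(\<Sum>i\<in>UNIV. of_real (L $ i) * x $ i) = 0" "x \<noteq> 0"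
    and eig: "map_matrix of_int (subst_matrix \<theta>) *v x = z *s x"
  shows "cmod z < 1"
proof (cases "z = of_real lam")
  case True
  let ?r = "\<chi> i. Re (x $ i)" and ?m = "\<chi> i. Im (x $ i)"
  have "?r = 0"
  proof (rule PF_eigenspace_inter_H)
    show "?r \<in> H" using arg_cong[OF x(1), of Re] by (simp add: H_iff inner_vec_def)
    show "M *v ?r = lam *\<^sub>R ?r"
      unfolding M_def matrix_vector_mult_Re_Im eig True by (simp add: vec_eq_iff)
  qed
  moreover have "?m = 0"
  proof (rule PF_eigenspace_inter_H)
    show "?m \<in> H" using arg_cong[OF x(1), of Im] by (simp add: H_iff inner_vec_def)
    show "M *v ?m = lam *\<^sub>R ?m"
      unfolding M_def matrix_vector_mult_Re_Im eig True by (simp add: vec_eq_iff)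
  qed
  ultimately have "x = 0" by (simp add: vec_eq_iff complex_eq_iff)
  with x show ?thesis by simp
next
  case False
  have "R \<noteq> 0" using LR by auto
  then have "int_eval (characteristic_poly (subst_matrix \<theta>)) lam = 0"
    using M_R by (intro eigenvector_imp_root_characteristic_poly[of _ R])
      (simp_all add: M_def scalar_mult_eq_scaleR)
  moreover have "int_eval (characteristic_poly (subst_matrix \<theta>)) z = 0"
    using eig x(2) by (rule eigenvector_imp_root_characteristic_poly)
  ultimately show ?thesis
    using pisot False unfolding irreducible_pisot_def lam_def by (blast intro: pisot_conjugate_bound)
qed

text \<open>
  Eigenvalues live over the complex numbers, so the general summability result is applied to the
  complexification of the hyperplane.
\<close>
lemma summable_norm_M_power:
  assumes "x \<in> H"
  shows "summable (\<lambda>k. norm (M_power k x))"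
proof -
  let ?A = "map_matrix of_int (subst_matrix \<theta>) :: complex ^ 'd ^ 'd"
  let ?S = "{x :: complex ^ 'd. (\<Sum>i\<in>UNIV. of_real (L $ i) * x $ i) = 0}"
  let ?c = "\<lambda>x :: real ^ 'd. (\<chi> i. complex_of_real (x $ i))"
  have c: "?A *v ?c y = ?c (M *v y)" for y
    by (simp add: vec_eq_iff matrix_vector_mult_def M_def)
  have pow: "((\<lambda>x. ?A *v x) ^^ k) (?c x) = ?c (M_power k x)" for k
    by (induction k) (simp_all add: c)
  have norm: "norm (?c y) = norm y" for y by (simp add: norm_vec_def)
  have LM: "(\<Sum>i\<in>UNIV. of_real (L $ i) * (?A *v y) $ i) = of_real lam * (\<Sum>i\<in>UNIV. of_real (L $ i) * y $ i)" for y
  proof -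
    have "L \<bullet> (M *v axis j 1) = lam * L $ j" for j
      by (simp add: inner_L_M inner_axis)
    then have col: "(\<Sum>i\<in>UNIV. L $ i * M $ i $ j) = lam * L $ j" for j
      by (simp add: inner_vec_def matrix_vector_mult_def axis_def if_distrib cong: if_cong)
    have "(\<Sum>i\<in>UNIV. of_real (L $ i) * (?A *v y) $ i)
        = (\<Sum>j\<in>UNIV. (\<Sum>i\<in>UNIV. of_real (L $ i) * of_real (M $ i $ j)) * y $ j)"
      unfolding matrix_vector_mult_def M_def
      by (simp add: sum_distrib_left sum_distrib_right mult.assoc) (rule sum.swap)
    also have "\<dots> = (\<Sum>j\<in>UNIV. of_real (lam * L $ j) * y $ j)"
      unfolding col[symmetric] by simp
    finally show ?thesis by (simp add: sum_distrib_left mult.assoc)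
  qed
  have "summable (\<lambda>k. norm (((\<lambda>x. ?A *v x) ^^ k) (?c x)))"
  proof (rule summable_norm_iterates[where S = ?S])
    show "?c x \<in> ?S"
      using assms by (simp add: H_iff inner_vec_def flip: of_real_mult of_real_sum)
    show "cmod z < 1" if "y \<in> ?S" "y \<noteq> 0" "?A *v y = z *s y" for y z
      using spectrum_H that by simp
    show "a *s y \<in> ?S" if "y \<in> ?S" for a y
    proof -
      have "(\<Sum>i\<in>UNIV. of_real (L $ i) * (a *s y) $ i) = a * (\<Sum>i\<in>UNIV. of_real (L $ i) * y $ i)"
        by (simp add: sum_distrib_left mult.left_commute)
      then show ?thesis using that by simp
    qed
  qed (simp_all add: LM matrix_vector_mult_diff_distrib vector_scalar_commute right_diff_distrib sum_subtractf)
  then show ?thesis by (simp add: pow norm)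
qed

text \<open>
  The standard trick to make an operator with summable orbits a strict contraction in one step:
  applying \<open>M\<close> removes the first term of the series, and that term is at least a fixed fraction of
  the sum because all norms on a finite-dimensional space are equivalent. A one-step contraction
  gives balls that are invariant under the affine maps met below.
\<close>
definition adapted_norm :: "real ^ 'd \<Rightarrow> real" where
  "adapted_norm x = (\<Sum>k. norm (M_power k x))"

lemma M_power_linear:
  "M_power k (x + y) = M_power k x + M_power k y"
  "M_power k (c *\<^sub>R x) = c *\<^sub>R M_power k x"
  by (induction k) (simp_all add: matrix_vector_right_distrib matrix_vector_mult_diff_distrib matrix_vector_mult_scaleR)

lemma M_power_H: "x \<in> H \<Longrightarrow> M_power k x \<in> H"
  by (induction k) (simp_all add: H_closed)

lemma adapted_norm_nonneg: "x \<in> H \<Longrightarrow> 0 \<le> adapted_norm x"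
  unfolding adapted_norm_def by (intro suminf_nonneg summable_norm_M_power) auto

lemma adapted_norm_triangle: "x \<in> H \<Longrightarrow> y \<in> H \<Longrightarrow> adapted_norm (x + y) \<le> adapted_norm x + adapted_norm y"
  unfolding adapted_norm_def suminf_add[OF summable_norm_M_power summable_norm_M_power]
  using norm_triangle_ineq
  by (intro suminf_le summable_norm_M_power summable_add H_closed) (auto simp: M_power_linear)

lemma adapted_norm_scaleR: "x \<in> H \<Longrightarrow> adapted_norm (c *\<^sub>R x) = \<bar>c\<bar> * adapted_norm x"
  unfolding adapted_norm_def by (simp add: M_power_linear suminf_mult summable_norm_M_power)

lemma adapted_norm_M: "x \<in> H \<Longrightarrow> adapted_norm (M *v x) = adapted_norm x - norm x"
  unfolding adapted_norm_def
  using suminf_split_head[OF summable_norm_M_power, of x] by (simp add: funpow_swap1)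

lemma norm_le_adapted_norm: "x \<in> H \<Longrightarrow> norm x \<le> adapted_norm x"
  using adapted_norm_M[of x] adapted_norm_nonneg[of "M *v x"] H_closed(5)[of x] by simp

lemma adapted_norm_bounded: "\<exists>C>0. \<forall>x\<in>H. adapted_norm x \<le> C * norm x"
proof -
  let ?p = "\<lambda>i. proj L R (axis i 1)"
  have p: "?p i \<in> H" for i
    unfolding H_def by (rule proj_is_projection_along) (simp add: LR)
  let ?C = "(\<Sum>i\<in>UNIV. adapted_norm (?p i))"
  have C: "?C \<ge> 0" by (simp add: sum_nonneg adapted_norm_nonneg p)
  have sum: "(\<Sum>i\<in>I. x $ i *\<^sub>R ?p i) \<in> H \<and> adapted_norm (\<Sum>i\<in>I. x $ i *\<^sub>R ?p i) \<le> (\<Sum>i\<in>I. \<bar>x $ i\<bar> * adapted_norm (?p i))" for I x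
  proof (induction I rule: infinite_finite_induct)
    case (insert i I)
    have "adapted_norm (x $ i *\<^sub>R ?p i + (\<Sum>i\<in>I. x $ i *\<^sub>R ?p i)) \<le> \<bar>x $ i\<bar> * adapted_norm (?p i) + adapted_norm (\<Sum>i\<in>I. x $ i *\<^sub>R ?p i)"
      using adapted_norm_triangle[OF H_closed(3)[OF p] insert.IH[THEN conjunct1], of "x $ i" i]
      unfolding adapted_norm_scaleR[OF p] .
    with insert p show ?case by (auto intro: H_closed)
  qed (simp_all add: H_closed adapted_norm_def M_power_linear(2)[of _ 0 0, simplified])
  have "adapted_norm x \<le> (?C + 1) * norm x" if "x \<in> H" for x
  proof -
    have lin: "linear (proj L R)" and "proj L R x = x"
      using that proj_is_projection_along[of L R] LR by (auto simp: H_def)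
    then have "x = proj L R (\<Sum>i\<in>UNIV. x $ i *\<^sub>R axis i 1)"
      using basis_expansion[of x] by (simp add: scalar_mult_eq_scaleR)
    also have "\<dots> = (\<Sum>i\<in>UNIV. x $ i *\<^sub>R ?p i)"
      using lin by (simp add: linear_sum linear_scale)
    finally have x: "(\<Sum>i\<in>UNIV. x $ i *\<^sub>R ?p i) = x" by simp
    have "adapted_norm x \<le> (\<Sum>i\<in>UNIV. \<bar>x $ i\<bar> * adapted_norm (?p i))"
      using sum[where x = x and I = UNIV] unfolding x by (rule conjunct2)
    also have "\<dots> \<le> (\<Sum>i\<in>UNIV. norm x * adapted_norm (?p i))"
      by (intro sum_mono mult_right_mono component_le_norm_cart adapted_norm_nonneg p)
    also have "\<dots> = ?C * norm x" by (simp add: sum_distrib_left mult.commute)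
    also have "\<dots> \<le> (?C + 1) * norm x" by (simp add: algebra_simps)
    finally show ?thesis .
  qed
  then show ?thesis using C by (intro exI[of _ "?C + 1"]) auto
qed

lemma adapted_norm_contraction:
  obtains \<kappa> where "0 \<le> \<kappa>" "\<kappa> < 1" "\<And>k x. x \<in> H \<Longrightarrow> adapted_norm (M_power k x) \<le> \<kappa> ^ k * adapted_norm x"
proof -
  obtain C where C: "C > 0" "\<And>x. x \<in> H \<Longrightarrow> adapted_norm x \<le> C * norm x" using adapted_norm_bounded by blast
  \<comment> \<open>\<open>C\<close> may be smaller than 1; with \<open>C + 1\<close> in its place the factor is nonnegative.\<close>
  let ?k = "1 - 1 / (C + 1)"
  have k: "0 \<le> ?k" "?k < 1" using C(1) by simp_all
  have step: "adapted_norm (M *v x) \<le> ?k * adapted_norm x" if "x \<in> H" for x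
  proof -
    have "adapted_norm x \<le> (C + 1) * norm x" using C(2)[OF that] norm_ge_zero[of x] unfolding distrib_right by linarith
    then have "adapted_norm x / (C + 1) \<le> norm x" using C(1) by (simp add: field_simps)
    then show ?thesis by (simp add: adapted_norm_M[OF that] algebra_simps)
  qed
  have "adapted_norm (M_power k x) \<le> ?k ^ k * adapted_norm x" if "x \<in> H" for k x
  proof (induction k)
    case (Suc k)
    have "adapted_norm (M_power (Suc k) x) \<le> ?k * adapted_norm (M_power k x)"
      using step[OF M_power_H[OF that]] by simp
    also have "\<dots> \<le> ?k * (?k ^ k * adapted_norm x)" by (rule mult_left_mono[OF Suc k(1)])
    finally show ?case by (simp add: mult.assoc)
  qed simp
  with k show ?thesis by (rule that)
qed

section \<open>Averages over the occurrences of a letter\<close>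

definition point :: "'d list \<Rightarrow> real ^ 'd" where "point u = proj L R (abelianise u)"

lemma abelianise_Nil: "abelianise [] = 0"
  and abelianise_append: "abelianise (u @ v) = abelianise u + abelianise v"
  and abelianise_single: "abelianise [i] = axis i 1"
  and abelianise_Cons: "abelianise (i # u) = axis i 1 + abelianise u"
  by (simp_all add: abelianise_def vec_eq_iff axis_def)

lemma proj_eq: "proj L R x = x - (L \<bullet> x) *\<^sub>R R" by (simp add: proj_def LR)

lemma proj_in_H: "proj L R x \<in> H" by (simp add: proj_eq H_iff inner_diff_right LR)

lemma proj_H: "x \<in> H \<Longrightarrow> proj L R x = x" by (simp add: proj_eq H_iff)

lemma point_in_H: "point u \<in> H" by (simp add: point_def proj_in_H)

lemma point_Nil: "point [] = 0" and point_append: "point (u @ v) = point u + point v"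
  by (simp_all add: point_def abelianise_Nil abelianise_append proj_eq inner_add_right algebra_simps)

lemma proj_M: "proj L R (M *v x) = M *v proj L R x"
  by (simp add: proj_eq inner_L_M matrix_vector_mult_diff_distrib matrix_vector_mult_scaleR M_R)

lemma finite_support: "finite (set_pmf (\<theta> i))"
  using rs by (auto simp: random_substitution_def)

lemma abelianise_image:
  assumes "w \<in> set_pmf (\<theta> i)" shows "abelianise w = M *v axis i 1"
proof -
  let ?w = "SOME v. v \<in> set_pmf (\<theta> i)"
  have "?w \<in> set_pmf (\<theta> i)" using assms by (rule someI)
  then have "abelianise w = abelianise ?w"
    using compat assms unfolding compatible_def by blast
  also have "\<dots> = M *v axis i 1"
    by (simp add: vec_eq_iff abelianise_def M_def subst_matrix_def matrix_vector_mult_def axis_def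
        if_distrib cong: if_cong)
  finally show ?thesis .
qed

lemma finite_subst_word: "finite (set_pmf (subst_word \<theta> u))"
  by (induction u) (simp_all add: finite_support)

lemma abelianise_subst_word: "w \<in> set_pmf (subst_word \<theta> u) \<Longrightarrow> abelianise w = M *v abelianise u"
proof (induction u arbitrary: w)
  case (Cons i u)
  then obtain v w' where "w = v @ w'" "v \<in> set_pmf (\<theta> i)" "w' \<in> set_pmf (subst_word \<theta> u)"
    by auto
  then show ?case
    using Cons.IH abelianise_image
    by (simp add: abelianise_append abelianise_Cons matrix_vector_right_distrib)
qed (simp add: abelianise_Nil)

lemma finite_subst_iter: "finite (set_pmf (subst_iter \<theta> n u))"
  by (induction n) (simp_all add: finite_subst_word)

lemma abelianise_subst_iter:
  "w \<in> set_pmf (subst_iter \<theta> n u) \<Longrightarrow> abelianise w = M_power n (abelianise u)"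
  by (induction n arbitrary: w) (auto simp: abelianise_subst_word)

lemma length_eq_sum_abelianise: "real (length w) = (\<Sum>a\<in>UNIV. abelianise w $ a)"
  by (induction w) (simp_all add: abelianise_Nil abelianise_Cons sum.distrib axis_def)

lemma iter_length_eq: "real (iter_length \<theta> n v) = (\<Sum>a\<in>UNIV. M_power n (abelianise v) $ a)"
proof -
  have "(SOME w. w \<in> set_pmf (subst_iter \<theta> n v)) \<in> set_pmf (subst_iter \<theta> n v)"
    using set_pmf_not_empty by (rule some_in_eq[THEN iffD2])
  then show ?thesis
    unfolding iter_length_def length_eq_sum_abelianise by (simp add: abelianise_subst_iter)
qed

text \<open>The integral of \<open>f\<close> against the measure that \<open>w\<close> defines for the letter \<open>a\<close>.\<close>
definition letter_sum :: "(real ^ 'd \<Rightarrow> real) \<Rightarrow> 'd \<Rightarrow> 'd list \<Rightarrow> real" where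
  "letter_sum f a w = (\<Sum>m<length w. if w ! m = a then f (point (take m w)) else 0)"

lemma letter_sum_Nil: "letter_sum f a [] = 0" by (simp add: letter_sum_def)

lemma letter_sum_Cons:
  "letter_sum f a (i # u) = (if i = a then f 0 else 0) + letter_sum (\<lambda>x. f (point [i] + x)) a u"
proof -
  have "point (take (Suc m) (i # u)) = point [i] + point (take m u)" for m
    using point_append[of "[i]" "take m u"] by simp
  then show ?thesis
    unfolding letter_sum_def length_Cons sum.lessThan_Suc_shift by (simp add: point_Nil del: take_Suc_Cons cong: if_cong)
qed

lemma letter_sum_append:
  "letter_sum f a (v @ w) = letter_sum f a v + letter_sum (\<lambda>x. f (point v + x)) a w"
proof (induction v arbitrary: f)
  case (Cons i v)
  then show ?case using point_append[of "[i]" v] by (simp add: letter_sum_Cons add.assoc)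
qed (simp add: letter_sum_Nil point_Nil)

lemma letter_sum_const: "letter_sum (\<lambda>_. c) a w = c * abelianise w $ a"
  by (induction w) (simp_all add: letter_sum_Nil letter_sum_Cons abelianise_def algebra_simps)

text \<open>
  The edges of the prefix automaton that lead to \<open>a\<close>: an occurrence, at position \<open>m\<close>, of \<open>a\<close> in
  a possible image \<open>w\<close> of the letter \<open>j\<close>. An occurrence of \<open>a\<close> in a substituted word
  arises from an occurrence of \<open>j\<close> in the original word together with such an edge; if \<open>x\<close> is the
  point of the original occurrence, the new one has the point \<open>offset (j, w, m) + M *v x\<close>.
\<close>
definition edges :: "'d \<Rightarrow> ('d \<times> 'd list \<times> nat) set" where
  "edges a = (SIGMA j:UNIV. SIGMA w:set_pmf (\<theta> j). {m. m < length w \<and> w ! m = a})"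

fun source :: "'d \<times> 'd list \<times> nat \<Rightarrow> 'd" where "source (j, w, m) = j"
fun weight :: "'d \<times> 'd list \<times> nat \<Rightarrow> real" where "weight (j, w, m) = pmf (\<theta> j) w"
fun offset :: "'d \<times> 'd list \<times> nat \<Rightarrow> real ^ 'd" where "offset (j, w, m) = point (take m w)"

lemma finite_edges: "finite (edges a)"
  unfolding edges_def by (intro finite_SigmaI finite_support) auto

lemma weight_nonneg: "0 \<le> weight e" by (cases e) simp

lemma offset_in_H: "offset e \<in> H" by (cases e) (simp add: point_in_H)

lemma sum_edges:
  "(\<Sum>e\<in>edges a. g e) = (\<Sum>j\<in>UNIV. \<Sum>w\<in>set_pmf (\<theta> j). \<Sum>m<length w. if w ! m = a then g (j, w, m) else 0)"
proof -
  have "(\<Sum>e\<in>edges a. g e)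
      = (\<Sum>j\<in>UNIV. \<Sum>w\<in>set_pmf (\<theta> j). \<Sum>m | m < length w \<and> w ! m = a. g (j, w, m))"
    unfolding edges_def by (simp add: sum.Sigma finite_support split_def)
  also have "\<dots> = (\<Sum>j\<in>UNIV. \<Sum>w\<in>set_pmf (\<theta> j). \<Sum>m<length w. if w ! m = a then g (j, w, m) else 0)"
    by (intro sum.cong[OF refl]) (subst sum.inter_filter[symmetric], auto intro: sum.cong)
  finally show ?thesis .
qed

text \<open>
  Compatibility makes the shift caused by the image of a first letter \<open>i\<close> the same for all
  realisations, namely \<open>M *v point [i]\<close>, so that the expectation can be computed letter by letter
  although the positions in later images depend on the earlier ones.
\<close>
lemma expectation_subst_word:
  "measure_pmf.expectation (subst_word \<theta> u) (letter_sum f a)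
    = (\<Sum>e\<in>edges a. weight e * letter_sum (\<lambda>x. f (offset e + M *v x)) (source e) u)"
proof (induction u arbitrary: f)
  case Nil
  then show ?case by (simp add: letter_sum_Nil)
next
  case (Cons i u)
  let ?E = "measure_pmf.expectation" and ?S = "set_pmf (\<theta> i)"
  let ?rest = "\<Sum>e\<in>edges a. weight e * letter_sum (\<lambda>x. f (M *v point [i] + (offset e + M *v x))) (source e) u"
  have point_v: "point v = M *v point [i]" if "v \<in> ?S" for v
    using abelianise_image[OF that] by (simp add: point_def proj_M abelianise_single)
  have int: "integrable (measure_pmf (subst_word \<theta> u)) g" for g :: "'d list \<Rightarrow> real"
    by (rule integrable_measure_pmf_finite[OF finite_subst_word])
  have app: "?E (subst_word \<theta> u) (\<lambda>w. letter_sum f a (v @ w)) = letter_sum f a v + ?rest" if "v \<in> ?S" for v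
    using Cons.IH[of "\<lambda>x. f (M *v point [i] + x)"]
    by (simp add: letter_sum_append int point_v[OF that])
  have one: "(\<Sum>v\<in>?S. pmf (\<theta> i) v) = 1"
    by (rule sum_pmf_eq_1) (use finite_support in auto)
  have "?E (subst_word \<theta> (i # u)) (letter_sum f a)
      = (\<Sum>v\<in>?S. pmf (\<theta> i) v *\<^sub>R ?E (subst_word \<theta> u \<bind> (\<lambda>w. return_pmf (v @ w))) (letter_sum f a))"
    unfolding subst_word.simps
    by (rule pmf_expectation_bind) (use finite_support finite_subst_word in auto)
  also have "\<dots> = (\<Sum>v\<in>?S. pmf (\<theta> i) v * (letter_sum f a v + ?rest))"
    by (intro sum.cong refl) (simp add: app flip: map_pmf_def)
  also have "\<dots> = (\<Sum>v\<in>?S. pmf (\<theta> i) v * letter_sum f a v) + ?rest"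
    by (simp add: distrib_left sum.distrib one flip: sum_distrib_right)
  also have "(\<Sum>v\<in>?S. pmf (\<theta> i) v * letter_sum f a v)
      = (\<Sum>e\<in>edges a. weight e * (if i = source e then f (offset e) else 0))"
  proof -
    have "(\<Sum>e\<in>edges a. weight e * (if i = source e then f (offset e) else 0))
        = (\<Sum>j\<in>UNIV. if i = j then \<Sum>v\<in>?S. pmf (\<theta> i) v * letter_sum f a v else 0)"
      unfolding sum_edges
      by (intro sum.cong refl) (auto simp: letter_sum_def sum_distrib_left intro!: sum.cong sum.neutral)
    then show ?thesis by simp
  qed
  also have "\<dots> + ?rest = (\<Sum>e\<in>edges a. weight e * letter_sum (\<lambda>x. f (offset e + M *v x)) (source e) (i # u))"
    by (simp add: letter_sum_Cons distrib_left sum.distrib matrix_vector_right_distrib add.left_commute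
        cong: if_cong)
  finally show ?case .
qed

definition expected_sum :: "nat \<Rightarrow> 'd list \<Rightarrow> (real ^ 'd \<Rightarrow> real) \<Rightarrow> 'd \<Rightarrow> real" where
  "expected_sum n v f a = measure_pmf.expectation (subst_iter \<theta> n v) (letter_sum f a)"

lemma expected_sum_0: "expected_sum 0 v f a = letter_sum f a v" by (simp add: expected_sum_def)

text \<open>
  The random substitution as a transfer operator: its last step becomes a weighted sum over affine
  maps applied to the argument of \<open>f\<close>, and the random words need not be followed any more.
\<close>
lemma expected_sum_Suc:
  "expected_sum (Suc n) v f a = (\<Sum>e\<in>edges a. weight e * expected_sum n v (\<lambda>x. f (offset e + M *v x)) (source e))"
proof -
  have int: "integrable (measure_pmf (subst_iter \<theta> n v)) g" for g :: "'d list \<Rightarrow> real"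
    by (rule integrable_measure_pmf_finite[OF finite_subst_iter])
  let ?S = "set_pmf (subst_iter \<theta> n v)"
  have "expected_sum (Suc n) v f a
      = (\<Sum>u\<in>?S. pmf (subst_iter \<theta> n v) u *\<^sub>R measure_pmf.expectation (subst_word \<theta> u) (letter_sum f a))"
    unfolding expected_sum_def subst_iter.simps
    by (rule pmf_expectation_bind) (use finite_subst_iter finite_subst_word in auto)
  also have "\<dots> = measure_pmf.expectation (subst_iter \<theta> n v)
      (\<lambda>u. \<Sum>e\<in>edges a. weight e * letter_sum (\<lambda>x. f (offset e + M *v x)) (source e) u)"
    unfolding expectation_subst_word
    by (subst integral_measure_pmf[OF finite_subst_iter]) auto
  also have "\<dots> = (\<Sum>e\<in>edges a. weight e * expected_sum n v (\<lambda>x. f (offset e + M *v x)) (source e))"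
    by (simp add: expected_sum_def int)
  finally show ?thesis .
qed

lemma expected_sum_const: "expected_sum n v (\<lambda>_. c) a = c * M_power n (abelianise v) $ a"
proof -
  have "expected_sum n v (\<lambda>_. c) a
      = measure_pmf.expectation (subst_iter \<theta> n v) (\<lambda>w. c * M_power n (abelianise v) $ a)"
    unfolding expected_sum_def
    by (intro integral_cong_AE) (auto simp: AE_measure_pmf_iff letter_sum_const abelianise_subst_iter)
  then show ?thesis by simp
qed

lemma expected_sum_mono:
  assumes "\<And>m. m < length v \<Longrightarrow> point (take m v) \<in> B"
    and "\<And>b e x. e \<in> edges b \<Longrightarrow> x \<in> B \<Longrightarrow> offset e + M *v x \<in> B"
    and "\<And>x. x \<in> B \<Longrightarrow> f x \<le> g x"
  shows "expected_sum n v f a \<le> expected_sum n v g a"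
  using assms(3)
proof (induction n arbitrary: f g a)
  case 0
  then show ?case unfolding expected_sum_0 letter_sum_def by (intro sum_mono) (simp add: assms(1))
next
  case (Suc n)
  show ?case unfolding expected_sum_Suc
    by (intro sum_mono mult_left_mono weight_nonneg Suc.IH Suc.prems assms(2))
qed

text \<open>
  The weights with source \<open>j\<close> add up to the matrix entry \<open>M $ a $ j\<close>, so this is the eigenvector
  equation for \<open>R\<close>.
\<close>
lemma sum_weight: "(\<Sum>e\<in>edges a. weight e * R $ source e) = lam * R $ a"
proof -
  have "(\<Sum>e\<in>edges a. weight e * R $ source e)
      = (\<Sum>j\<in>UNIV. \<Sum>w\<in>set_pmf (\<theta> j). pmf (\<theta> j) w * R $ j * letter_sum (\<lambda>_. 1) a w)"
    unfolding sum_edges letter_sum_def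
    by (simp add: sum_distrib_left if_distrib cong: if_cong)
  also have "\<dots> = (\<Sum>j\<in>UNIV. \<Sum>w\<in>set_pmf (\<theta> j). pmf (\<theta> j) w * (M $ a $ j * R $ j))"
  proof (intro sum.cong refl)
    fix j w assume "w \<in> set_pmf (\<theta> j)"
    then have "abelianise w $ a = M $ a $ j"
      by (simp add: abelianise_image matrix_vector_mult_def axis_def if_distrib cong: if_cong)
    then show "pmf (\<theta> j) w * R $ j * letter_sum (\<lambda>_. 1) a w = pmf (\<theta> j) w * (M $ a $ j * R $ j)"
      by (simp add: letter_sum_const)
  qed
  also have "\<dots> = (\<Sum>j\<in>UNIV. M $ a $ j * R $ j)"
    by (simp add: finite_support sum_pmf_eq_1 flip: sum_distrib_right)
  also have "\<dots> = lam * R $ a"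
    using arg_cong[OF M_R, of "\<lambda>x. x $ a"] by (simp add: matrix_vector_mult_def)
  finally show ?thesis .
qed

end

section \<open>Random points of the limit measure\<close>

lemma (in prob_space) stream_space_eq_pair_distr:
  "stream_space M = distr (M \<Otimes>\<^sub>M stream_space M) (stream_space M) (\<lambda>(x, X). x ## X)"
proof (rule measure_eqI)
  interpret S: prob_space "stream_space M" by (rule prob_space_stream_space)
  fix A assume A[measurable]: "A \<in> sets (stream_space M)"
  have "emeasure (distr (M \<Otimes>\<^sub>M stream_space M) (stream_space M) (\<lambda>(x, X). x ## X)) A
      = (\<integral>\<^sup>+X. indicator A X \<partial>distr (M \<Otimes>\<^sub>M stream_space M) (stream_space M) (\<lambda>(x, X). x ## X))"
    by simp
  also have "\<dots> = (\<integral>\<^sup>+p. indicator A ((\<lambda>(x, X). x ## X) p) \<partial>(M \<Otimes>\<^sub>M stream_space M))"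
    by (rule nn_integral_distr) measurable
  also have "\<dots> = (\<integral>\<^sup>+x. \<integral>\<^sup>+X. indicator A (x ## X) \<partial>stream_space M \<partial>M)"
    by (subst S.nn_integral_fst[symmetric]) simp_all
  also have "\<dots> = (\<integral>\<^sup>+X. indicator A X \<partial>stream_space M)"
    by (subst nn_integral_stream_space) simp_all
  finally show "emeasure (stream_space M) A
      = emeasure (distr (M \<Otimes>\<^sub>M stream_space M) (stream_space M) (\<lambda>(x, X). x ## X)) A"
    by simp
qed simp

lemma (in prob_space) integral_stream_space:
  fixes f :: "'a stream \<Rightarrow> real"
  assumes [measurable]: "f \<in> borel_measurable (stream_space M)" and bound: "\<And>X. \<bar>f X\<bar> \<le> C"
  shows "(\<integral>X. f X \<partial>stream_space M) = (\<integral>x. (\<integral>X. f (x ## X) \<partial>stream_space M) \<partial>M)"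
proof -
  interpret S: prob_space "stream_space M" by (rule prob_space_stream_space)
  interpret P: pair_prob_space M "stream_space M" ..
  have "(\<integral>X. f X \<partial>stream_space M)
      = (\<integral>p. f ((\<lambda>(x, X). x ## X) p) \<partial>(M \<Otimes>\<^sub>M stream_space M))"
    by (subst stream_space_eq_pair_distr, subst integral_distr) simp_all
  also have "\<dots> = (\<integral>x. (\<integral>X. f (x ## X) \<partial>stream_space M) \<partial>M)"
    by (subst P.integral_fst'[symmetric])
      (auto intro!: P.integrable_const_bound[where B = C] simp: bound)
  finally show ?thesis .
qed

context pisot_substitution
begin

text \<open>
  The Markov chain on letters that undoes the substitution: a letter \<open>a\<close> chooses the edge by which
  it was created. Since \<open>R\<close> is an eigenvector, the weights below are probabilities.
\<close>
definition kernel :: "'d \<Rightarrow> ('d \<times> 'd list \<times> nat) pmf" where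
  "kernel a = embed_pmf (\<lambda>e. if e \<in> edges a then weight e * R $ source e / (lam * R $ a) else 0)"

lemma pmf_kernel: "pmf (kernel a) e = (if e \<in> edges a then weight e * R $ source e / (lam * R $ a) else 0)"
  unfolding kernel_def
proof (rule pmf_embed_pmf)
  let ?f = "\<lambda>e. if e \<in> edges a then weight e * R $ source e / (lam * R $ a) else 0"
  show nn: "0 \<le> ?f e" for e
    using weight_nonneg R_pos lam_gt_1 by (simp add: less_imp_le)
  have "(\<integral>\<^sup>+e. ennreal (?f e) \<partial>count_space UNIV) = (\<Sum>e\<in>edges a. ennreal (?f e))"
    by (rule nn_integral_count_space'[OF finite_edges]) auto
  also have "\<dots> = ennreal (\<Sum>e\<in>edges a. ?f e)"
    by (rule sum_ennreal) (rule nn)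
  also have "(\<Sum>e\<in>edges a. ?f e) = (\<Sum>e\<in>edges a. weight e * R $ source e) / (lam * R $ a)"
    by (simp add: sum_divide_distrib)
  also have "\<dots> = 1" using lam_gt_1 R_pos[of a] by (simp add: sum_weight)
  finally show "(\<integral>\<^sup>+e. ennreal (?f e) \<partial>count_space UNIV) = 1" by simp
qed

lemma set_kernel: "set_pmf (kernel a) \<subseteq> edges a"
  by (auto simp: set_pmf_iff pmf_kernel split: if_splits)

text \<open>
  All letters choose an edge, independently. A stream of independent such choices determines
  the path of the chain from every starting letter at once.
\<close>
definition choices :: "('d \<Rightarrow> 'd \<times> 'd list \<times> nat) pmf" where
  "choices = Pi_pmf UNIV undefined kernel"

lemma map_choices: "map_pmf (\<lambda>g. g a) choices = kernel a"
  unfolding choices_def by (subst Pi_pmf_component) auto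

lemma choices_edges: "g \<in> set_pmf choices \<Longrightarrow> g a \<in> edges a"
  using set_kernel[of a] by (auto simp flip: map_choices)

lemma expectation_choices:
  fixes \<phi> :: "_ \<Rightarrow> real"
  shows "measure_pmf.expectation choices (\<lambda>g. \<phi> (g a))
    = (\<Sum>e\<in>edges a. weight e * R $ source e / (lam * R $ a) * \<phi> e)"
proof -
  have "measure_pmf.expectation choices (\<lambda>g. \<phi> (g a)) = measure_pmf.expectation (kernel a) \<phi>"
    by (simp flip: map_choices)
  also have "\<dots> = (\<Sum>e\<in>edges a. \<phi> e * pmf (kernel a) e)"
    by (rule integral_measure_pmf_real[OF finite_edges]) (use set_kernel in auto)
  finally show ?thesis by (simp add: pmf_kernel mult.commute)
qed

definition paths :: "('d \<Rightarrow> 'd \<times> 'd list \<times> nat) stream measure" where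
  "paths = stream_space (measure_pmf choices)"

lemma prob_space_paths: "prob_space paths"
  unfolding paths_def by (rule prob_space.prob_space_stream_space[OF prob_space_measure_pmf])

text \<open>
  Horner's scheme for the sum of \<open>M_power k (offset e\<^sub>k)\<close> over \<open>k < n\<close>, where \<open>e\<^sub>0, e\<^sub>1, \<dots>\<close> are the
  edges that the chain started at \<open>a\<close> follows.
\<close>
primrec partial_point :: "nat \<Rightarrow> 'd \<Rightarrow> ('d \<Rightarrow> 'd \<times> 'd list \<times> nat) stream \<Rightarrow> real ^ 'd" where
  "partial_point 0 a \<omega> = 0"
| "partial_point (Suc n) a \<omega> = offset (shd \<omega> a) + M *v partial_point n (source (shd \<omega> a)) (stl \<omega>)"

lemma measurable_partial_point [measurable]: "partial_point n a \<in> borel_measurable paths"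
  unfolding paths_def
proof (induction n arbitrary: a)
  case 0
  then show ?case by (simp add: fun_eq_iff[of "partial_point 0 a"])
next
  case (Suc n)
  note Suc[measurable]
  have "(\<lambda>\<omega>. (\<lambda>e \<omega>. offset e + M *v partial_point n (source e) (stl \<omega>)) (shd \<omega> a) \<omega>)
      \<in> borel_measurable (stream_space (measure_pmf choices))"
  proof (rule measurable_compose_countable[where g = "\<lambda>\<omega>. shd \<omega> a"
        and f = "\<lambda>e \<omega>. offset e + M *v partial_point n (source e) (stl \<omega>)"])
    fix e
    have "(\<lambda>x. offset e + M *v x) \<in> borel_measurable borel"
      by (intro borel_measurable_continuous_onI continuous_intros)
    then show "(\<lambda>\<omega>. offset e + M *v partial_point n (source e) (stl \<omega>))
        \<in> borel_measurable (stream_space (measure_pmf choices))"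
      by (rule measurable_compose[rotated]) measurable
  next
    have "(\<lambda>g. g a) \<in> measurable (measure_pmf choices) (count_space UNIV)" by simp
    then show "(\<lambda>\<omega>. shd \<omega> a) \<in> measurable (stream_space (measure_pmf choices)) (count_space UNIV)"
      by (rule measurable_compose[rotated]) measurable
  qed
  then show ?case by (simp add: fun_eq_iff cong: measurable_cong_simp)
qed

definition path_mean :: "nat \<Rightarrow> 'd \<Rightarrow> (real ^ 'd \<Rightarrow> real) \<Rightarrow> real" where
  "path_mean n a f = (\<integral>\<omega>. f (partial_point n a \<omega>) \<partial>paths)"

lemma path_mean_0: "path_mean 0 a f = f 0"
proof -
  interpret prob_space paths by (rule prob_space_paths)
  show ?thesis by (simp add: path_mean_def prob_space)
qed

text \<open>
  The recursion of \<open>expected_sum_Suc\<close> with the weights normalised by \<open>R\<close>.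
\<close>
lemma path_mean_Suc:
  assumes f: "continuous_on UNIV f" "\<And>x. \<bar>f x\<bar> \<le> C"
  shows "lam * R $ a * path_mean (Suc n) a f
    = (\<Sum>e\<in>edges a. weight e * R $ source e * path_mean n (source e) (\<lambda>x. f (offset e + M *v x)))"
proof -
  have [measurable]: "f \<in> borel_measurable borel" by (rule borel_measurable_continuous_onI[OF f(1)])
  have "path_mean (Suc n) a f
      = (\<integral>g. (\<integral>\<omega>. f (partial_point (Suc n) a (g ## \<omega>)) \<partial>paths) \<partial>measure_pmf choices)"
    unfolding path_mean_def paths_def
    by (rule prob_space.integral_stream_space[OF prob_space_measure_pmf, where C = C])
      (unfold paths_def[symmetric], measurable, simp add: f(2))
  also have "\<dots> = (\<integral>g. path_mean n (source (g a)) (\<lambda>x. f (offset (g a) + M *v x)) \<partial>measure_pmf choices)"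
    by (simp add: path_mean_def)
  also have "\<dots> = (\<Sum>e\<in>edges a. weight e * R $ source e / (lam * R $ a)
      * path_mean n (source e) (\<lambda>x. f (offset e + M *v x)))"
    by (rule expectation_choices)
  finally show ?thesis
    using lam_gt_1 R_pos[of a] by (simp add: sum_distrib_left)
qed

text \<open>
  The projection only matters on the null set of streams that leave the support of the choices:
  it places the limit in the hyperplane there as well.
\<close>
definition limit_point :: "'d \<Rightarrow> ('d \<Rightarrow> 'd \<times> 'd list \<times> nat) stream \<Rightarrow> real ^ 'd" where
  "limit_point a \<omega> = proj L R (lim (\<lambda>n. partial_point n a \<omega>))"

lemma continuous_proj: "continuous_on UNIV (proj L R)"
  unfolding proj_eq[abs_def] by (intro continuous_intros)

lemma measurable_limit_point [measurable]: "limit_point a \<in> borel_measurable paths"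
proof -
  have [measurable]: "proj L R \<in> borel_measurable borel"
    by (rule borel_measurable_continuous_onI[OF continuous_proj])
  show ?thesis unfolding limit_point_def[abs_def] by measurable
qed

lemma limit_point_in_H: "limit_point a \<omega> \<in> H" by (simp add: limit_point_def proj_in_H)

lemma partial_point_in_H: "partial_point n a \<omega> \<in> H"
  by (induction n arbitrary: a \<omega>) (simp_all add: H_closed offset_in_H)

text \<open>
  Two consecutive partial points differ by \<open>M_power n\<close> of an offset, and there are finitely many
  offsets; the contraction therefore gives a geometric bound.
\<close>
lemma partial_point_tendsto:
  assumes "stream_all (\<lambda>g. \<forall>a. g a \<in> edges a) \<omega>"
  shows "(\<lambda>n. partial_point n a \<omega>) \<longlonglongrightarrow> limit_point a \<omega>"
proof -
  obtain \<kappa> where \<kappa>: "0 \<le> \<kappa>" "\<kappa> < 1" "\<And>k x. x \<in> H \<Longrightarrow> adapted_norm (M_power k x) \<le> \<kappa> ^ k * adapted_norm x"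
    by (rule adapted_norm_contraction) (rule that)
  define r where "r = Max (insert 0 (adapted_norm ` offset ` (\<Union>a. edges a)))"
  have r: "adapted_norm (offset e) \<le> r" if "e \<in> edges a" for e a
    unfolding r_def using that by (intro Max_ge) (auto simp: finite_edges)
  have "adapted_norm (partial_point (Suc n) a \<omega> - partial_point n a \<omega>) \<le> \<kappa> ^ n * r" for n
    using assms
  proof (induction n arbitrary: a \<omega>)
    case 0
    then show ?case
      by (auto simp: stream.pred_set matrix_vector_mult_0_right intro!: r stream.set_sel)
  next
    case (Suc n)
    let ?d = "partial_point (Suc n) (source (shd \<omega> a)) (stl \<omega>) - partial_point n (source (shd \<omega> a)) (stl \<omega>)"
    have "adapted_norm (partial_point (Suc (Suc n)) a \<omega> - partial_point (Suc n) a \<omega>) = adapted_norm (M *v ?d)"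
      by (simp add: matrix_vector_mult_diff_distrib)
    also have "\<dots> \<le> \<kappa> * adapted_norm ?d"
      using \<kappa>(3)[of ?d 1] by (simp add: H_closed partial_point_in_H del: partial_point.simps)
    also have "\<dots> \<le> \<kappa> * (\<kappa> ^ n * r)"
      using Suc.prems
      by (intro mult_left_mono Suc.IH \<kappa>(1)) (auto simp: stream.pred_set intro: stl_sset)
    finally show ?case by (simp add: mult.assoc)
  qed
  then have le: "norm (partial_point (Suc n) a \<omega> - partial_point n a \<omega>) \<le> \<kappa> ^ n * r" for n
    using norm_le_adapted_norm H_closed(4) partial_point_in_H order_trans by blast
  have "summable (\<lambda>n. \<kappa> ^ n * r)" using \<kappa> by (intro summable_mult2 summable_geometric) simp
  then have "summable (\<lambda>n. partial_point (Suc n) a \<omega> - partial_point n a \<omega>)"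
    by (rule summable_comparison_test'[where N = 0]) (rule le)
  then have "(\<lambda>n. \<Sum>i<n. partial_point (Suc i) a \<omega> - partial_point i a \<omega>) \<longlonglongrightarrow>
      (\<Sum>n. partial_point (Suc n) a \<omega> - partial_point n a \<omega>)"
    by (rule summable_LIMSEQ)
  then have "convergent (\<lambda>n. partial_point n a \<omega>)"
    unfolding sum_lessThan_telescope[of "\<lambda>n. partial_point n a \<omega>"] by (auto simp: convergent_def)
  then have lim: "(\<lambda>n. partial_point n a \<omega>) \<longlonglongrightarrow> lim (\<lambda>n. partial_point n a \<omega>)"
    by (simp add: convergent_LIMSEQ_iff)
  then have "lim (\<lambda>n. partial_point n a \<omega>) \<in> H"
    by (rule closed_sequentially[OF closed_H, rotated]) (simp add: partial_point_in_H)
  then show ?thesis using lim by (simp add: limit_point_def proj_H)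
qed

lemma path_mean_tendsto:
  assumes f: "continuous_on UNIV f" "\<And>x. \<bar>f x\<bar> \<le> C"
  shows "(\<lambda>n. path_mean n a f) \<longlonglongrightarrow> (\<integral>\<omega>. f (limit_point a \<omega>) \<partial>paths)"
proof -
  interpret P: prob_space paths by (rule prob_space_paths)
  have [measurable]: "f \<in> borel_measurable borel" by (rule borel_measurable_continuous_onI[OF f(1)])
  have "AE \<omega> in paths. stream_all (\<lambda>g. \<forall>a. g a \<in> edges a) \<omega>"
    unfolding paths_def
    by (rule prob_space.AE_stream_all[OF prob_space_measure_pmf]) (auto simp: AE_measure_pmf_iff choices_edges)
  then have "AE \<omega> in paths. (\<lambda>n. f (partial_point n a \<omega>)) \<longlonglongrightarrow> f (limit_point a \<omega>)"
  proof eventually_elim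
    case (elim \<omega>)
    then show ?case
      using f(1) by (intro continuous_on_tendsto_compose[OF f(1)] partial_point_tendsto) auto
  qed
  then show ?thesis
    unfolding path_mean_def
    by (intro integral_dominated_convergence[where w = "\<lambda>_. C"]) (auto simp: f(2))
qed

section \<open>Comparison of the averages with the random points\<close>

lemma adapted_norm_M_power_le: "x \<in> H \<Longrightarrow> adapted_norm (M_power k x) \<le> adapted_norm x"
proof (induction k)
  case (Suc k)
  let ?y = "M_power k x"
  have "adapted_norm (M *v ?y) \<le> adapted_norm ?y"
    using adapted_norm_M[OF M_power_H[OF Suc.prems, of k]] norm_ge_zero[of ?y] by linarith
  then show ?case using Suc by simp
qed simp

text \<open>
  The component of \<open>abelianise v\<close> along \<open>R\<close> grows like \<open>lam ^ k\<close> and the one in the hyperplane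
  stays bounded.
\<close>
lemma mass_estimate:
  "\<bar>M_power k (abelianise v) $ a - lam ^ k * ((L \<bullet> abelianise v) * R $ a)\<bar> \<le> adapted_norm (point v)"
proof -
  have powR: "M_power k R = lam ^ k *\<^sub>R R"
    by (induction k) (simp_all add: matrix_vector_mult_scaleR M_R)
  have "abelianise v = (L \<bullet> abelianise v) *\<^sub>R R + point v" by (simp add: point_def proj_eq)
  then have "M_power k (abelianise v)
      = (L \<bullet> abelianise v) *\<^sub>R lam ^ k *\<^sub>R R + M_power k (point v)"
    by (metis M_power_linear(1,2) powR)
  then have "M_power k (abelianise v) $ a - lam ^ k * ((L \<bullet> abelianise v) * R $ a)
      = M_power k (point v) $ a"
    by simp
  also have "\<bar>\<dots>\<bar> \<le> norm (M_power k (point v))" by (rule component_le_norm_cart)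
  also have "\<dots> \<le> adapted_norm (M_power k (point v))" by (intro norm_le_adapted_norm M_power_H point_in_H)
  also have "\<dots> \<le> adapted_norm (point v)" by (rule adapted_norm_M_power_le[OF point_in_H])
  finally show ?thesis .
qed

definition adapted_ball :: "real \<Rightarrow> (real ^ 'd) set" where "adapted_ball r = {x \<in> H. adapted_norm x \<le> r}"

lemma zero_in_adapted_ball: "0 \<le> r \<Longrightarrow> 0 \<in> adapted_ball r"
  using adapted_norm_scaleR[OF H_closed(1), of 0] by (simp add: adapted_ball_def H_closed)

text \<open>
  With \<open>s\<close> a bound for all offsets and starting points and \<open>\<kappa>\<close> the contraction factor, the radius
  \<open>r = s / (1 - \<kappa>)\<close> solves \<open>s + \<kappa> * r = r\<close>.
\<close>
lemma invariant_ball: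
  obtains r where "0 \<le> r" "\<And>m. point (take m v) \<in> adapted_ball r"
    "\<And>e a x. e \<in> edges a \<Longrightarrow> x \<in> adapted_ball r \<Longrightarrow> offset e + M *v x \<in> adapted_ball r"
proof -
  obtain \<kappa> where \<kappa>: "0 \<le> \<kappa>" "\<kappa> < 1" "\<And>k x. x \<in> H \<Longrightarrow> adapted_norm (M_power k x) \<le> \<kappa> ^ k * adapted_norm x"
    by (rule adapted_norm_contraction) (rule that)
  define S where "S = insert 0 (adapted_norm ` offset ` (\<Union>a. edges a)) \<union> (\<lambda>m. adapted_norm (point (take m v))) ` {..length v}"
  define s where "s = Max S"
  have fin: "finite S" unfolding S_def by (simp add: finite_edges)
  have s0: "0 \<le> s" unfolding s_def by (rule Max_ge[OF fin]) (simp add: S_def)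
  have s: "adapted_norm (offset e) \<le> s" if "e \<in> edges a" for e a
    unfolding s_def by (rule Max_ge[OF fin]) (use that in \<open>unfold S_def, blast\<close>)
  have v: "adapted_norm (point (take m v)) \<le> s" for m
  proof -
    have "take m v = take (min m (length v)) v" by (simp add: min_def)
    then show ?thesis unfolding s_def by (intro Max_ge fin) (auto simp: S_def)
  qed
  let ?r = "s / (1 - \<kappa>)"
  have r: "s \<le> ?r" "s + \<kappa> * ?r = ?r" using s0 \<kappa>(1,2) by (simp_all add: field_simps mult_left_le)
  show ?thesis
  proof (rule that[of ?r])
    show "0 \<le> ?r" using r s0 by linarith
    show "point (take m v) \<in> adapted_ball ?r" for m using v[of m] r by (simp add: adapted_ball_def point_in_H)
    fix e a x assume e: "e \<in> edges a" and x: "x \<in> adapted_ball ?r"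
    have xH: "x \<in> H" using x by (simp add: adapted_ball_def)
    have "adapted_norm (offset e + M *v x) \<le> adapted_norm (offset e) + adapted_norm (M *v x)"
      by (intro adapted_norm_triangle offset_in_H H_closed(5) xH)
    also have "\<dots> \<le> s + \<kappa> * ?r"
      using s[OF e] \<kappa>(3)[OF xH, of 1] mult_left_mono[of "adapted_norm x" ?r \<kappa>] x \<kappa>(1) by (simp add: adapted_ball_def)
    finally show "offset e + M *v x \<in> adapted_ball ?r"
      using r(2) xH by (simp add: adapted_ball_def H_closed offset_in_H)
  qed
qed

text \<open>
  If \<open>f\<close> is nearly constant on the ball that contains all points, its average is nearly the value
  at the origin times the number of occurrences of the letter.
\<close>
lemma expected_sum_near_constant:
  assumes B: "0 \<le> r" "\<And>m. point (take m v) \<in> adapted_ball r"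
      "\<And>e a x. e \<in> edges a \<Longrightarrow> x \<in> adapted_ball r \<Longrightarrow> offset e + M *v x \<in> adapted_ball r"
    and f: "\<And>x. x \<in> adapted_ball r \<Longrightarrow> \<bar>f x - f 0\<bar> \<le> \<epsilon>" "\<bar>f 0\<bar> \<le> C"
  shows "\<bar>expected_sum k v f a - lam ^ k * ((L \<bullet> abelianise v) * R $ a) * f 0\<bar>
    \<le> \<epsilon> * (lam ^ k * ((L \<bullet> abelianise v) * R $ a) + r) + C * r"
proof -
  let ?m = "M_power k (abelianise v) $ a" and ?l = "lam ^ k * ((L \<bullet> abelianise v) * R $ a)"
  have "0 \<le> \<epsilon>" using f(1)[OF zero_in_adapted_ball[OF B(1)]] by simp
  have "adapted_norm (point v) \<le> r" using B(2)[of "length v"] by (simp add: adapted_ball_def)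
  then have m: "\<bar>?m - ?l\<bar> \<le> r" using mass_estimate[of k v a] by linarith
  have "expected_sum k v f a \<le> expected_sum k v (\<lambda>_. f 0 + \<epsilon>) a"
    by (rule expected_sum_mono[where B = "adapted_ball r"]) (use B f in \<open>force simp: abs_le_iff\<close>)+
  moreover have "expected_sum k v (\<lambda>_. f 0 - \<epsilon>) a \<le> expected_sum k v f a"
    by (rule expected_sum_mono[where B = "adapted_ball r"]) (use B f in \<open>force simp: abs_le_iff\<close>)+
  ultimately have "\<bar>expected_sum k v f a - ?m * f 0\<bar> \<le> \<epsilon> * ?m"
    by (simp add: expected_sum_const abs_le_iff algebra_simps)
  moreover have "\<epsilon> * ?m \<le> \<epsilon> * (?l + r)"
    using m \<open>0 \<le> \<epsilon>\<close> by (intro mult_left_mono) auto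
  moreover have "\<bar>?m * f 0 - ?l * f 0\<bar> \<le> C * r"
    using mult_mono[OF f(2) m] f(2) by (simp add: abs_mult flip: left_diff_distrib) (simp add: mult.commute)
  ultimately show ?thesis by linarith
qed

text \<open>
  Both sides satisfy the same recursion in \<open>n\<close>, and its weights carry an error proportional to
  \<open>R\<close> from one step to the next without loss. The hypothesis on \<open>f\<close> says that \<open>n\<close> affine maps
  have shrunk the ball so far that \<open>f\<close> varies by at most \<open>\<epsilon>\<close> on its image; composing \<open>f\<close> with one of these
  maps leaves the hypothesis for \<open>n - 1\<close> of them.
\<close>
lemma expected_sum_near_path_mean:
  assumes B: "\<And>e a x. e \<in> edges a \<Longrightarrow> x \<in> adapted_ball r \<Longrightarrow> offset e + M *v x \<in> adapted_ball r" "0 \<in> adapted_ball r"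
    and base: "\<And>g a. (\<And>x. x \<in> adapted_ball r \<Longrightarrow> \<bar>g x - g 0\<bar> \<le> \<epsilon>) \<Longrightarrow> \<bar>g 0\<bar> \<le> C \<Longrightarrow>
      \<bar>expected_sum k v g a - lam ^ k * (c * R $ a) * g 0\<bar> \<le> lam ^ k * R $ a * \<rho>"
    and f: "continuous_on UNIV f" "\<And>x. \<bar>f x\<bar> \<le> C"
      "\<And>x y. x \<in> adapted_ball r \<Longrightarrow> y \<in> adapted_ball r \<Longrightarrow> \<bar>f (y + M_power n x) - f y\<bar> \<le> \<epsilon>"
  shows "\<bar>expected_sum (n + k) v f a - lam ^ (n + k) * (c * R $ a) * path_mean n a f\<bar> \<le> lam ^ (n + k) * R $ a * \<rho>"
  using f
proof (induction n arbitrary: f a)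
  case 0
  have "\<bar>f x - f 0\<bar> \<le> \<epsilon>" if "x \<in> adapted_ball r" for x using 0(3)[OF that B(2)] by simp
  then show ?case using base[of f a] 0(2) by (simp add: path_mean_0)
next
  case (Suc n)
  let ?f = "\<lambda>e x. f (offset e + M *v x)"
  have IH: "\<bar>expected_sum (n + k) v (?f e) (source e) - lam ^ (n + k) * (c * R $ source e) * path_mean n (source e) (?f e)\<bar>
      \<le> lam ^ (n + k) * R $ source e * \<rho>" if e: "e \<in> edges a" for e
  proof (rule Suc.IH)
    show "continuous_on UNIV (?f e)"
      by (rule continuous_on_compose2[OF Suc.prems(1)]) (auto intro!: continuous_intros)
    show "\<bar>?f e x\<bar> \<le> C" for x by (rule Suc.prems(2))
    show "\<bar>?f e (y + M_power n x) - ?f e y\<bar> \<le> \<epsilon>" if "x \<in> adapted_ball r" "y \<in> adapted_ball r" for x y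
      using Suc.prems(3)[OF that(1) B(1)[OF e that(2)]]
      by (simp add: matrix_vector_right_distrib add.assoc)
  qed
  have "lam ^ (Suc n + k) * (c * R $ a) * path_mean (Suc n) a f
      = (\<Sum>e\<in>edges a. weight e * (lam ^ (n + k) * (c * R $ source e) * path_mean n (source e) (?f e)))"
  proof -
    have "lam ^ (Suc n + k) * (c * R $ a) * path_mean (Suc n) a f
        = lam ^ (n + k) * c * (lam * R $ a * path_mean (Suc n) a f)" by simp
    then show ?thesis
      unfolding path_mean_Suc[OF Suc.prems(1,2)] by (simp add: sum_distrib_left mult_ac)
  qed
  then have "\<bar>expected_sum (Suc n + k) v f a - lam ^ (Suc n + k) * (c * R $ a) * path_mean (Suc n) a f\<bar>
      = \<bar>\<Sum>e\<in>edges a. weight e * (expected_sum (n + k) v (?f e) (source e)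
          - lam ^ (n + k) * (c * R $ source e) * path_mean n (source e) (?f e))\<bar>"
    by (simp add: expected_sum_Suc right_diff_distrib sum_subtractf)
  also have "\<dots> \<le> (\<Sum>e\<in>edges a. weight e * (lam ^ (n + k) * R $ source e * \<rho>))"
    by (rule order_trans[OF sum_abs], rule sum_mono)
      (simp add: abs_mult weight_nonneg mult_left_mono[OF IH])
  also have "\<dots> = lam ^ (n + k) * \<rho> * (\<Sum>e\<in>edges a. weight e * R $ source e)"
    by (simp add: sum_distrib_left mult_ac)
  also have "\<dots> = lam ^ (Suc n + k) * R $ a * \<rho>" by (simp add: sum_weight)
  finally show ?case .
qed

lemma uniformly_small_increment:
  assumes f: "continuous_on UNIV f" and "0 < \<epsilon>"
  shows "\<forall>\<^sub>F n in sequentially. \<forall>x\<in>adapted_ball r. \<forall>y\<in>adapted_ball r. \<bar>f (y + M_power n x) - f y\<bar> \<le> (\<epsilon>::real)"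
proof -
  obtain \<kappa> where \<kappa>: "0 \<le> \<kappa>" "\<kappa> < 1" "\<And>k x. x \<in> H \<Longrightarrow> adapted_norm (M_power k x) \<le> \<kappa> ^ k * adapted_norm x"
    by (rule adapted_norm_contraction) (rule that)
  have "uniformly_continuous_on (cball 0 (2 * r)) f"
    by (rule compact_uniformly_continuous) (auto intro: continuous_on_subset[OF f])
  then obtain \<delta> where \<delta>: "0 < \<delta>"
    "\<And>x y. x \<in> cball 0 (2 * r) \<Longrightarrow> y \<in> cball 0 (2 * r) \<Longrightarrow> dist y x < \<delta> \<Longrightarrow> dist (f y) (f x) < \<epsilon>"
    using \<open>0 < \<epsilon>\<close> unfolding uniformly_continuous_on_def by metis
  have "(\<lambda>n. \<kappa> ^ n * r) \<longlonglongrightarrow> 0 * r"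
    using \<kappa> by (intro tendsto_mult LIMSEQ_power_zero tendsto_const) simp
  then have "\<forall>\<^sub>F n in sequentially. \<kappa> ^ n * r < \<delta>"
    using \<delta>(1) by (intro order_tendstoD(2)[where a = \<delta>]) auto
  then show ?thesis
  proof eventually_elim
    case (elim n)
    show ?case
    proof (intro ballI)
      fix x y assume "x \<in> adapted_ball r" "y \<in> adapted_ball r"
      then have x: "x \<in> H" "adapted_norm x \<le> r" and y: "norm y \<le> r"
        using norm_le_adapted_norm[of y] by (auto simp: adapted_ball_def)
      have a: "norm (M_power n x) \<le> adapted_norm (M_power n x)"
        by (intro norm_le_adapted_norm M_power_H x)
      also have "\<dots> \<le> \<kappa> ^ n * r"
        using \<kappa>(3)[OF x(1), of n] mult_left_mono[OF x(2), of "\<kappa> ^ n"] \<kappa>(1) by simp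
      finally have small: "norm (M_power n x) < \<delta>" using elim by simp
      have "norm (M_power n x) \<le> r"
        using a adapted_norm_M_power_le[OF x(1), of n] x(2) by linarith
      then have "norm (y + M_power n x) \<le> 2 * r"
        using norm_triangle_ineq[of y "M_power n x"] y by linarith
      moreover have "norm y \<le> 2 * r" using y norm_ge_zero[of y] by linarith
      moreover have "dist (y + M_power n x) y < \<delta>" using small by (simp add: dist_norm)
      ultimately have "dist (f (y + M_power n x)) (f y) < \<epsilon>"
        by (intro \<delta>(2)) (simp_all only: mem_cball_0)
      then show "\<bar>f (y + M_power n x) - f y\<bar> \<le> \<epsilon>" by (simp add: dist_real_def)
    qed
  qed
qed

lemma lam_power_decay: "(\<lambda>k. s / lam ^ k) \<longlonglongrightarrow> 0"
proof -
  have "(\<lambda>k. s * (1 / lam) ^ k) \<longlonglongrightarrow> s * 0"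
    using lam_gt_1 by (intro tendsto_mult tendsto_const LIMSEQ_power_zero) simp
  then show ?thesis by (simp add: power_one_over)
qed

lemma R_le_1: "R $ a \<le> 1"
proof -
  have "\<bar>R $ a\<bar> \<le> (\<Sum>i\<in>UNIV. \<bar>R $ i\<bar>)" by (rule member_le_sum) auto
  then show ?thesis using sum_R by linarith
qed

lemma L_abelianise_nonneg: "0 \<le> L \<bullet> abelianise v"
  and L_abelianise_pos: "v \<noteq> [] \<Longrightarrow> 0 < L \<bullet> abelianise v"
proof -
  show nn: "0 \<le> L \<bullet> abelianise v" for v
    by (auto simp: inner_vec_def abelianise_def L_pos less_imp_le intro!: sum_nonneg mult_nonneg_nonneg)
  show "0 < L \<bullet> abelianise v" if "v \<noteq> []"
  proof (cases v)
    case (Cons i u)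
    then show ?thesis using nn[of u] L_pos[of i]
      by (simp add: abelianise_Cons inner_add_right inner_axis)
  qed (use that in simp)
qed

text \<open>
  The number of steps is split as \<open>n + k\<close>. A large fixed \<open>n\<close> makes the image of the ball small and
  brings \<open>path_mean n\<close> close to its limit; then \<open>k\<close> tends to infinity, and the number of
  occurrences of each letter after \<open>k\<close> steps is asymptotically proportional to \<open>R\<close>.
\<close>
lemma expected_sum_tendsto:
  assumes f: "continuous_on UNIV f" "\<And>x. \<bar>f x\<bar> \<le> C"
  shows "(\<lambda>n. expected_sum n v f a / lam ^ n)
    \<longlonglongrightarrow> (L \<bullet> abelianise v) * R $ a * (\<integral>\<omega>. f (limit_point a \<omega>) \<partial>paths)"
proof (rule LIMSEQ_I)
  fix e :: real assume "0 < e"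
  let ?c = "L \<bullet> abelianise v" and ?I = "\<integral>\<omega>. f (limit_point a \<omega>) \<partial>paths"
  have c: "0 \<le> ?c" by (rule L_abelianise_nonneg)
  \<comment> \<open>Relative to \<open>lam ^ k * R $ b\<close> the base case has an error of at most \<open>\<epsilon> * ?c\<close> from the variation
    of the test function and \<open>\<epsilon>\<close> from the bounded terms, once \<open>k \<ge> k0\<close>; this is below \<open>e / 2\<close>.\<close>
  define \<epsilon> where "\<epsilon> = e / (2 * (?c + 2))"
  have \<epsilon>: "0 < \<epsilon>" "\<epsilon> * (?c + 2) = e / 2" using \<open>0 < e\<close> c by (simp_all add: \<epsilon>_def field_simps)
  have C: "0 \<le> C" using f(2)[of 0] by linarith
  obtain r where r: "0 \<le> r" "\<And>m. point (take m v) \<in> adapted_ball r"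
    "\<And>e a x. e \<in> edges a \<Longrightarrow> x \<in> adapted_ball r \<Longrightarrow> offset e + M *v x \<in> adapted_ball r"
    by (rule invariant_ball[of v]) (rule that)
  have "\<forall>\<^sub>F k in sequentially. \<forall>b. (\<epsilon> * r + C * r) / R $ b / lam ^ k < \<epsilon>"
    by (intro eventually_all_finite order_tendstoD(2)[OF lam_power_decay] \<epsilon>)
  then obtain k0 where k0: "\<And>k b. k0 \<le> k \<Longrightarrow> (\<epsilon> * r + C * r) / R $ b / lam ^ k < \<epsilon>"
    unfolding eventually_sequentially by blast
  have "(\<lambda>n. ?c * R $ a * path_mean n a f) \<longlonglongrightarrow> ?c * R $ a * ?I"
    by (intro tendsto_mult tendsto_const path_mean_tendsto[OF f])
  then have "\<forall>\<^sub>F n in sequentially. dist (?c * R $ a * path_mean n a f) (?c * R $ a * ?I) < e / 2"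
    using \<open>0 < e\<close> by (intro tendstoD) auto
  then have "\<forall>\<^sub>F n in sequentially. dist (?c * R $ a * path_mean n a f) (?c * R $ a * ?I) < e / 2 \<and>
      (\<forall>x\<in>adapted_ball r. \<forall>y\<in>adapted_ball r. \<bar>f (y + M_power n x) - f y\<bar> \<le> \<epsilon>)"
    using uniformly_small_increment[OF f(1) \<epsilon>(1)] by (rule eventually_conj)
  then obtain n where n: "dist (?c * R $ a * path_mean n a f) (?c * R $ a * ?I) < e / 2"
    "\<And>x y. x \<in> adapted_ball r \<Longrightarrow> y \<in> adapted_ball r \<Longrightarrow> \<bar>f (y + M_power n x) - f y\<bar> \<le> \<epsilon>"
    unfolding eventually_sequentially by blast
  show "\<exists>N0. \<forall>N\<ge>N0. norm (expected_sum N v f a / lam ^ N - ?c * R $ a * ?I) < e"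
  proof (intro exI allI impI)
    fix N assume N: "n + k0 \<le> N"
    define k where "k = N - n"
    have k: "k0 \<le> k" "N = n + k" using N by (auto simp: k_def)
    have base: "\<bar>expected_sum k v g b - lam ^ k * (?c * R $ b) * g 0\<bar> \<le> lam ^ k * R $ b * (e / 2)"
      if g: "\<And>x. x \<in> adapted_ball r \<Longrightarrow> \<bar>g x - g 0\<bar> \<le> \<epsilon>" "\<bar>g 0\<bar> \<le> C" for g b
    proof -
      have pos: "0 < lam ^ k * R $ b" using lam_gt_1 R_pos[of b] by simp
      then have "\<epsilon> * r + C * r \<le> lam ^ k * R $ b * \<epsilon>"
        using k0[OF k(1), of b] by (simp add: field_simps)
      moreover have "0 \<le> lam ^ k * R $ b * \<epsilon>" using pos \<epsilon>(1) by simp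
      moreover have "\<epsilon> * (lam ^ k * (?c * R $ b) + r) + C * r
          = lam ^ k * R $ b * (\<epsilon> * ?c) + (\<epsilon> * r + C * r)" by (simp add: algebra_simps)
      moreover have "lam ^ k * R $ b * (e / 2) = lam ^ k * R $ b * (\<epsilon> * ?c) + 2 * (lam ^ k * R $ b * \<epsilon>)"
        unfolding \<epsilon>(2)[symmetric] by (simp add: algebra_simps)
      moreover have "\<bar>expected_sum k v g b - lam ^ k * (?c * R $ b) * g 0\<bar>
          \<le> \<epsilon> * (lam ^ k * (?c * R $ b) + r) + C * r"
        by (rule expected_sum_near_constant) (fact r g)+
      ultimately show ?thesis by linarith
    qed
    have "\<bar>expected_sum N v f a - lam ^ N * (?c * R $ a) * path_mean n a f\<bar> \<le> lam ^ N * R $ a * (e / 2)"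
      unfolding k(2)
      by (rule expected_sum_near_path_mean[OF r(3) zero_in_adapted_ball[OF r(1)] base f n(2)])
    also have "\<dots> \<le> lam ^ N * (e / 2)"
      using R_le_1[of a] lam_gt_1 \<open>0 < e\<close> by (simp add: mult_left_le)
    finally have "\<bar>expected_sum N v f a - lam ^ N * (?c * R $ a) * path_mean n a f\<bar> / lam ^ N \<le> e / 2"
      using lam_gt_1 by (simp add: field_simps)
    moreover have "expected_sum N v f a / lam ^ N - ?c * R $ a * path_mean n a f
        = (expected_sum N v f a - lam ^ N * (?c * R $ a) * path_mean n a f) / lam ^ N"
      using lam_gt_1 by (simp add: field_simps)
    ultimately have "\<bar>expected_sum N v f a / lam ^ N - ?c * R $ a * path_mean n a f\<bar> \<le> e / 2"
      using lam_gt_1 by (simp add: abs_divide)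
    then show "norm (expected_sum N v f a / lam ^ N - ?c * R $ a * ?I) < e"
      using n(1) unfolding dist_real_def real_norm_def by linarith
  qed
qed

text \<open>The preceding limit for the constant function 1 counts letters.\<close>
lemma iter_length_tendsto: "(\<lambda>n. real (iter_length \<theta> n v) / lam ^ n) \<longlonglongrightarrow> L \<bullet> abelianise v"
proof -
  have mass: "(\<lambda>n. M_power n (abelianise v) $ a / lam ^ n) \<longlonglongrightarrow> (L \<bullet> abelianise v) * R $ a" for a
    using expected_sum_tendsto[of "\<lambda>_. 1" 1 v a] prob_space.prob_space[OF prob_space_paths]
    by (simp add: expected_sum_const)
  have "(\<Sum>a\<in>UNIV. R $ a) = 1" using sum_R R_pos by (simp add: less_imp_le abs_of_nonneg)
  then have "(\<Sum>a\<in>UNIV. (L \<bullet> abelianise v) * R $ a) = L \<bullet> abelianise v"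
    by (simp flip: sum_distrib_left)
  then show ?thesis
    using tendsto_sum[of UNIV "\<lambda>a n. M_power n (abelianise v) $ a / lam ^ n", OF mass] by (simp add: iter_length_eq sum_divide_distrib)
qed

end

section \<open>Weak convergence\<close>

lemma integral_scale_measure:
  fixes f :: "'a \<Rightarrow> real"
  assumes "0 \<le> c" and f: "f \<in> borel_measurable N"
  shows "(\<integral>x. f x \<partial>scale_measure (ennreal c) N) = c * (\<integral>x. f x \<partial>N)"
proof -
  have "scale_measure (ennreal c) N = density N (\<lambda>_. ennreal c)"
    by (rule measure_eqI) (simp_all add: emeasure_density_const)
  then show ?thesis using integral_density[OF f, of "\<lambda>_. c"] assms(1) by simp
qed

context pisot_substitution
begin

text \<open>
  A random word with finitely many values turns the averaged measure into a finite weighted sum of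
  point masses, indexed by the occurrences of \<open>a\<close> in the possible words.
\<close>
lemma averaged_measure_eq_distr:
  fixes a :: 'd
  assumes fin: "finite (set_pmf W)"
  defines "F \<equiv> SIGMA w:set_pmf W. {m. m < length w \<and> w ! m = a}"
  shows "averaged_measure L R a W
    = distr (point_measure F (\<lambda>(w, m). pmf W w)) (hyperplane_borel L) (\<lambda>(w, m). point (take m w))"
    (is "_ = distr ?P _ ?g")
proof (rule measure_eqI)
  have finF: "finite F" unfolding F_def by (intro finite_SigmaI fin) auto
  have g: "?g \<in> measurable ?P (hyperplane_borel L)"
    using point_in_H by (auto simp: measurable_def space_point_measure sets_point_measure space_restrict_space H_def)
  fix B assume "B \<in> sets (averaged_measure L R a W)"
  then have B: "B \<in> sets (hyperplane_borel L)" by simp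
  have "emeasure (averaged_measure L R a W) B
      = (\<Sum>w\<in>set_pmf W. emeasure (letter_measure L R a w) B * ennreal (pmf W w))"
    unfolding emeasure_averaged_measure[OF B]
    by (rule nn_integral_measure_pmf_finite[OF fin]) simp
  also have "\<dots> = (\<Sum>w\<in>set_pmf W. \<Sum>m | m < length w \<and> w ! m = a. ennreal (pmf W w) * indicator B (point (take m w)))"
    unfolding emeasure_letter_measure[OF B] sum_distrib_right
    by (intro sum.cong refl) (simp add: B point_def mult.commute)
  also have "\<dots> = (\<Sum>p\<in>F. (case p of (w, m) \<Rightarrow> ennreal (pmf W w)) * indicator B (?g p))"
    unfolding F_def by (subst sum.Sigma) (auto simp: fin split_def)
  also have "\<dots> = (\<Sum>p\<in>?g -` B \<inter> F. case p of (w, m) \<Rightarrow> ennreal (pmf W w))"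
    using finF by (intro sum.mono_neutral_cong_right) (auto simp: indicator_def)
  also have "\<dots> = emeasure (distr ?P (hyperplane_borel L) ?g) B"
    using B g finF
    by (subst emeasure_distr) (auto simp: emeasure_point_measure_finite space_point_measure split_def)
  finally show "emeasure (averaged_measure L R a W) B = emeasure (distr ?P (hyperplane_borel L) ?g) B" .
qed simp

lemma integral_averaged_measure:
  assumes fin: "finite (set_pmf W)" and f: "continuous_on H f"
  shows "(\<integral>x. f x \<partial>averaged_measure L R a W)
    = measure_pmf.expectation W (letter_sum (\<lambda>x. f (proj L R x)) a)"
proof -
  define F where "F = (SIGMA w:set_pmf W. {m. m < length w \<and> w ! m = a})"
  let ?P = "point_measure F (\<lambda>(w, m). pmf W w)" and ?g = "\<lambda>(w, m). point (take m w)"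
  have finF: "finite F" unfolding F_def by (intro finite_SigmaI fin) auto
  have g: "?g \<in> measurable ?P (hyperplane_borel L)"
    using point_in_H by (auto simp: measurable_def space_point_measure sets_point_measure space_restrict_space H_def)
  have "f \<in> borel_measurable (hyperplane_borel L)"
    using f unfolding H_def by (rule borel_measurable_continuous_on_restrict)
  then have "(\<integral>x. f x \<partial>averaged_measure L R a W) = (\<integral>p. f (?g p) \<partial>?P)"
    unfolding averaged_measure_eq_distr[OF fin] F_def[symmetric] using g by (rule integral_distr[rotated])
  also have "\<dots> = (\<Sum>p\<in>F. (case p of (w, m) \<Rightarrow> pmf W w) *\<^sub>R f (?g p))"
    by (rule lebesgue_integral_point_measure_finite[OF finF]) auto
  also have "\<dots> = (\<Sum>w\<in>set_pmf W. \<Sum>m | m < length w \<and> w ! m = a. pmf W w * f (point (take m w)))"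
    unfolding F_def by (subst sum.Sigma) (auto simp: fin split_def)
  also have "\<dots> = (\<Sum>w\<in>set_pmf W. letter_sum (\<lambda>x. f (proj L R x)) a w * pmf W w)"
  proof (rule sum.cong[OF refl])
    fix w
    have "(\<Sum>m | m < length w \<and> w ! m = a. pmf W w * f (point (take m w)))
        = (\<Sum>m\<in>{m\<in>{..<length w}. w ! m = a}. pmf W w * f (point (take m w)))"
      by (rule sum.cong) auto
    also have "\<dots> = letter_sum (\<lambda>x. f (proj L R x)) a w * pmf W w"
      unfolding letter_sum_def
      by (subst sum.inter_filter)
        (simp_all add: sum_distrib_left proj_H point_in_H if_distrib mult.commute cong: if_cong)
    finally show "(\<Sum>m | m < length w \<and> w ! m = a. pmf W w * f (point (take m w)))
        = letter_sum (\<lambda>x. f (proj L R x)) a w * pmf W w" .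
  qed
  also have "\<dots> = measure_pmf.expectation W (letter_sum (\<lambda>x. f (proj L R x)) a)"
    by (rule integral_measure_pmf_real[OF fin, symmetric])
  finally show ?thesis .
qed

definition limit_measure :: "'d \<Rightarrow> (real ^ 'd) measure" where
  "limit_measure a = scale_measure (ennreal (R $ a)) (distr paths (hyperplane_borel L) (limit_point a))"

lemma measurable_limit_point_hyperplane: "limit_point a \<in> measurable paths (hyperplane_borel L)"
  using limit_point_in_H by (intro measurable_restrict_space2) (auto simp: H_def)

lemma sets_limit_measure: "sets (limit_measure a) = sets (hyperplane_borel L)"
  by (simp add: limit_measure_def)

lemma emeasure_limit_measure_space: "emeasure (limit_measure a) (hyperplane L) = ennreal (R $ a)"
proof -
  interpret prob_space "distr paths (hyperplane_borel L) (limit_point a)"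
    by (rule prob_space.prob_space_distr[OF prob_space_paths measurable_limit_point_hyperplane])
  show ?thesis
    using emeasure_space_1 by (simp add: limit_measure_def space_restrict_space)
qed

text \<open>
  A test function is only defined on the hyperplane; composed with the projection it extends to a
  bounded continuous function on the whole space. Dividing numerator and denominator by \<open>lam ^ n\<close>
  cancels the dependence on \<open>v\<close>.
\<close>
lemma weakly_converges_to_limit_measure:
  assumes "v \<noteq> []"
  shows "weakly_converges_on (hyperplane L)
    (\<lambda>n. scale_measure (ennreal (1 / real (iter_length \<theta> n v)))
      (averaged_measure L R a (subst_iter \<theta> n v)))
    (limit_measure a)"
  unfolding weakly_converges_on_def H_def[symmetric]
proof (intro allI impI, elim conjE)
  fix f :: "real ^ 'd \<Rightarrow> real" assume f: "continuous_on H f" "bounded (f ` H)"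
  let ?f = "\<lambda>x. f (proj L R x)" and ?c = "L \<bullet> abelianise v"
  obtain C where C: "\<And>x. x \<in> H \<Longrightarrow> \<bar>f x\<bar> \<le> C" using f(2) by (auto simp: bounded_iff)
  have cont: "continuous_on UNIV ?f"
    by (rule continuous_on_compose2[OF f(1) continuous_proj]) (auto simp: proj_in_H)
  have meas: "f \<in> borel_measurable (hyperplane_borel L)"
    using f(1) unfolding H_def by (rule borel_measurable_continuous_on_restrict)
  have lim: "(\<integral>x. f x \<partial>limit_measure a) = R $ a * (\<integral>\<omega>. ?f (limit_point a \<omega>) \<partial>paths)"
    unfolding limit_measure_def
    using R_pos[of a] meas measurable_limit_point_hyperplane
    by (simp add: integral_scale_measure integral_distr proj_H limit_point_in_H less_imp_le)
  have "(\<integral>x. f x \<partial>scale_measure (ennreal (1 / real (iter_length \<theta> n v)))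
      (averaged_measure L R a (subst_iter \<theta> n v)))
      = (expected_sum n v ?f a / lam ^ n) / (real (iter_length \<theta> n v) / lam ^ n)" for n
  proof -
    have "f \<in> borel_measurable (averaged_measure L R a (subst_iter \<theta> n v))"
      using meas by (simp cong: measurable_cong_sets)
    then show ?thesis
      using lam_gt_1
      by (simp add: integral_scale_measure integral_averaged_measure[OF finite_subst_iter f(1)] expected_sum_def)
  qed
  moreover have "(\<lambda>n. (expected_sum n v ?f a / lam ^ n) / (real (iter_length \<theta> n v) / lam ^ n))
      \<longlonglongrightarrow> (?c * R $ a * (\<integral>\<omega>. ?f (limit_point a \<omega>) \<partial>paths)) / ?c"
    using L_abelianise_pos[OF assms] C proj_in_H
    by (intro tendsto_divide expected_sum_tendsto[OF cont] iter_length_tendsto) auto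
  ultimately show "(\<lambda>n. \<integral>x. f x \<partial>scale_measure (ennreal (1 / real (iter_length \<theta> n v)))
      (averaged_measure L R a (subst_iter \<theta> n v))) \<longlonglongrightarrow> (\<integral>x. f x \<partial>limit_measure a)"
    using L_abelianise_pos[OF assms] by (simp add: lim)
qed

end

theorem proposition5p6:
  fixes \<theta> :: "'d::finite \<Rightarrow> 'd list pmf" and L R :: "real ^ 'd"
  assumes "random_substitution \<theta>" and "compatible \<theta>" and "irreducible_pisot \<theta>"
    and "left_PF_eigenvector (subst_matrix \<theta>) L"
    and "right_PF_eigenvector (subst_matrix \<theta>) R"
    and "(\<Sum>i\<in>UNIV. \<bar>R $ i\<bar>) = 1" and "L \<bullet> R = 1"
  shows "\<exists>\<mu> :: 'd \<Rightarrow> (real ^ 'd) measure.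
    (\<forall>a. sets (\<mu> a) = sets (restrict_space borel (hyperplane L)) \<and> finite_measure (\<mu> a)) \<and>
    (\<forall>v. v \<noteq> [] \<longrightarrow> (\<forall>a. weakly_converges_on (hyperplane L)
       (\<lambda>n. scale_measure (ennreal (1 / real (iter_length \<theta> n v)))
              (averaged_measure L R a (subst_iter \<theta> n v)))
       (\<mu> a))) \<and>
    (\<chi> a. measure (\<mu> a) (hyperplane L)) = R"
proof -
  interpret pisot_substitution \<theta> L R
    using assms by unfold_locales
  have space: "space (limit_measure a) = hyperplane L" for a
    using sets_eq_imp_space_eq[OF sets_limit_measure] by (simp add: space_restrict_space)
  show ?thesis
  proof (intro exI[of _ limit_measure] conjI allI impI)
    show "finite_measure (limit_measure a)" for a
      by (rule finite_measureI) (simp add: space emeasure_limit_measure_space)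
    show "(\<chi> a. measure (limit_measure a) (hyperplane L)) = R"
      using R_pos by (simp add: vec_eq_iff measure_def emeasure_limit_measure_space less_imp_le)
  qed (simp_all add: sets_limit_measure weakly_converges_to_limit_measure)
qed

end
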